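(* Let $K$ be a field, let $(A,d)$ be a differential graded $K$-algebra and let $(S,\delta)$ be a dg-simple left dg-module over $(A,d)$. Then $(\mathrm{End}_A^\bullet(S,\delta),d_{\mathrm{Hom}})$ is a dg-division algebra. Moreover, the set of homogeneous left regular elements of $\ker(d_{\mathrm{Hom}})$ coincides with the set of homogeneous right regular elements of $\ker(d_{\mathrm{Hom}})$.
   Context: A dg-$K$-algebra $(A,d)$ is a unital associative $\mathbb{Z}$-graded $K$-algebra $A$ with a graded $K$-linear endomorphism $d$ of degree $1$ such that $d^2=0$ and $d(ab)=d(a)b+(-1)^{|a|}a\,d(b)$ for all homogeneous $a,b\in A$. A left dg-module $(M,\delta)$ over $(A,d)$ is a $\mathbb{Z}$-graded left $A$-module $M$ with an endomorphism $\delta$ of degree $1$, $\delta^2=0$, satisfying $\delta(am)=d(a)m+(-1)^{|a|}a\,\delta(m)$ for homogeneous $a\in A$, $m\in M$. It is dg-simple if it is nonzero and has no dg-submodule (graded $A$-submodule stable under $\delta$) other than $0$ and itself. $\mathrm{End}_A^\bullet(S,\delta)$ is the graded algebra under composition whose homogeneous elements $f$ of degree $|f|$ are the $K$-linear maps $S\to S$ homogeneous of degree $|f|$ with $f(am)=(-1)^{|a||f|}af(m)$ for homogeneous $a\in A$ and $m\in S$; its differential is $d_{\mathrm{Hom}}(f)=\delta\circ f-(-1)^{|f|}f\circ\delta$, and this makes it a dg-$K$-algebra. A dg-algebra is a dg-division algebra if it contains no dg-left ideal and no dg-right ideal (graded left, resp. right, ideal stable under the differential) other than $0$ and itself. A homogeneous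 element $u$ of a graded ring $R$ is right regular if $ux=0$ with $x\in R$ implies $x=0$, and left regular if $xu=0$ with $x\in R$ implies $x=0$. *)

theory Defs
  imports "HOL-Algebra.Module" "HOL-Algebra.AbelCoset"
begin

text \<open>One record type serves for dg-algebras over a ground field and for dg-modules over a
  dg-algebra; as usual for \<^typ>\<open>('a, 'b) module\<close>, the fields \<^const>\<open>monoid.mult\<close> and
  \<^const>\<open>monoid.one\<close> are ignored in the latter case.\<close>

record ('a, 'b) dg = "('a, 'b) module" +
  grade :: "int \<Rightarrow> 'b set"
  differential :: "'b \<Rightarrow> 'b"

text \<open>Multiplication by $(-1)^n$.\<close>

definition signed :: "('b, 'm) ring_scheme \<Rightarrow> int \<Rightarrow> 'b \<Rightarrow> 'b" where
  "signed M n x = (if even n then x else \<ominus>\<^bsub>M\<^esub> x)"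

definition decomposes :: "('a, 'b, 'm) dg_scheme \<Rightarrow> 'b \<Rightarrow> (int \<Rightarrow> 'b) \<Rightarrow> bool" where
  "decomposes M x c \<longleftrightarrow>
     (\<forall>n. c n \<in> grade M n) \<and> finite {n. c n \<noteq> \<zero>\<^bsub>M\<^esub>} \<and>
     x = (\<Oplus>\<^bsub>M\<^esub>n\<in>{n. c n \<noteq> \<zero>\<^bsub>M\<^esub>}. c n)"

locale graded_group = abelian_group M for M (structure) +
  assumes grade_subgroup: "additive_subgroup (grade M n) M"
    and direct_sum: "x \<in> carrier M \<Longrightarrow> \<exists>!c. decomposes M x c"

definition homogeneous :: "('a, 'b, 'm) dg_scheme \<Rightarrow> 'b set" where
  "homogeneous M = (\<Union>n. grade M n)"

definition graded_subgroup :: "('a, 'b, 'm) dg_scheme \<Rightarrow> 'b set \<Rightarrow> bool" where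
  "graded_subgroup M N \<longleftrightarrow>
     additive_subgroup N M \<and> (\<forall>x\<in>N. \<exists>c. (\<forall>n. c n \<in> N) \<and> decomposes M x c)"

text \<open>The library's \<open>algebra\<close> is commutative, hence the explicit compatibility of scalars with
  multiplication on either side.\<close>

locale dg_algebra = field K + module K A + ring A + graded_group A
  for K (structure) and A (structure) +
  assumes smult_mult_left:
      "\<lbrakk>k \<in> carrier K; a \<in> carrier A; b \<in> carrier A\<rbrakk> \<Longrightarrow>
        (k \<odot>\<^bsub>A\<^esub> a) \<otimes>\<^bsub>A\<^esub> b = k \<odot>\<^bsub>A\<^esub> (a \<otimes>\<^bsub>A\<^esub> b)"
    and smult_mult_right:
      "\<lbrakk>k \<in> carrier K; a \<in> carrier A; b \<in> carrier A\<rbrakk> \<Longrightarrow>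
        a \<otimes>\<^bsub>A\<^esub> (k \<odot>\<^bsub>A\<^esub> b) = k \<odot>\<^bsub>A\<^esub> (a \<otimes>\<^bsub>A\<^esub> b)"
    and grade_smult:
      "\<lbrakk>k \<in> carrier K; a \<in> grade A n\<rbrakk> \<Longrightarrow> k \<odot>\<^bsub>A\<^esub> a \<in> grade A n"
    and grade_mult:
      "\<lbrakk>a \<in> grade A m; b \<in> grade A n\<rbrakk> \<Longrightarrow> a \<otimes>\<^bsub>A\<^esub> b \<in> grade A (m + n)"
    and diff_add:
      "\<lbrakk>a \<in> carrier A; b \<in> carrier A\<rbrakk> \<Longrightarrow>
        differential A (a \<oplus>\<^bsub>A\<^esub> b) = differential A a \<oplus>\<^bsub>A\<^esub> differential A b"
    and diff_smult:
      "\<lbrakk>k \<in> carrier K; a \<in> carrier A\<rbrakk> \<Longrightarrow>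
        differential A (k \<odot>\<^bsub>A\<^esub> a) = k \<odot>\<^bsub>A\<^esub> differential A a"
    and diff_grade: "a \<in> grade A n \<Longrightarrow> differential A a \<in> grade A (n + 1)"
    and diff_diff: "a \<in> carrier A \<Longrightarrow> differential A (differential A a) = \<zero>\<^bsub>A\<^esub>"
    and diff_mult:
      "\<lbrakk>a \<in> grade A m; b \<in> grade A n\<rbrakk> \<Longrightarrow>
        differential A (a \<otimes>\<^bsub>A\<^esub> b) =
          differential A a \<otimes>\<^bsub>A\<^esub> b \<oplus>\<^bsub>A\<^esub> signed A m (a \<otimes>\<^bsub>A\<^esub> differential A b)"

text \<open>A ground field acts on an \<open>A\<close>-module through its image in \<open>A\<close>.\<close>

definition scal ::
    "('k, 'a, 'm) module_scheme \<Rightarrow> ('a, 's, 'n) module_scheme \<Rightarrow> 'k \<Rightarrow> 's \<Rightarrow> 's" where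
  "scal A S k x = (k \<odot>\<^bsub>A\<^esub> \<one>\<^bsub>A\<^esub>) \<odot>\<^bsub>S\<^esub> x"

definition K_linear ::
    "('k, 'l) ring_scheme \<Rightarrow> ('k, 'a, 'm) module_scheme \<Rightarrow> ('a, 's, 'n) module_scheme
      \<Rightarrow> ('s \<Rightarrow> 's) \<Rightarrow> bool" where
  "K_linear K A S f \<longleftrightarrow>
     f \<in> carrier S \<rightarrow> carrier S \<and>
     (\<forall>x\<in>carrier S. \<forall>y\<in>carrier S. f (x \<oplus>\<^bsub>S\<^esub> y) = f x \<oplus>\<^bsub>S\<^esub> f y) \<and>
     (\<forall>k\<in>carrier K. \<forall>x\<in>carrier S. f (scal A S k x) = scal A S k (f x))"

text \<open>The library's \<^locale>\<open>module\<close> requires commutative scalars, so the module axioms are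
  repeated here.\<close>

locale dg_left_module = A: dg_algebra K A + S: graded_group S
  for K (structure) and A (structure) and S (structure) +
  assumes act_closed: "\<lbrakk>a \<in> carrier A; x \<in> carrier S\<rbrakk> \<Longrightarrow> a \<odot>\<^bsub>S\<^esub> x \<in> carrier S"
    and act_l_distr:
      "\<lbrakk>a \<in> carrier A; b \<in> carrier A; x \<in> carrier S\<rbrakk> \<Longrightarrow>
        (a \<oplus>\<^bsub>A\<^esub> b) \<odot>\<^bsub>S\<^esub> x = a \<odot>\<^bsub>S\<^esub> x \<oplus>\<^bsub>S\<^esub> b \<odot>\<^bsub>S\<^esub> x"
    and act_r_distr:
      "\<lbrakk>a \<in> carrier A; x \<in> carrier S; y \<in> carrier S\<rbrakk> \<Longrightarrow>
        a \<odot>\<^bsub>S\<^esub> (x \<oplus>\<^bsub>S\<^esub> y) = a \<odot>\<^bsub>S\<^esub> x \<oplus>\<^bsub>S\<^esub> a \<odot>\<^bsub>S\<^esub> y"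
    and act_assoc:
      "\<lbrakk>a \<in> carrier A; b \<in> carrier A; x \<in> carrier S\<rbrakk> \<Longrightarrow>
        (a \<otimes>\<^bsub>A\<^esub> b) \<odot>\<^bsub>S\<^esub> x = a \<odot>\<^bsub>S\<^esub> (b \<odot>\<^bsub>S\<^esub> x)"
    and act_one: "x \<in> carrier S \<Longrightarrow> \<one>\<^bsub>A\<^esub> \<odot>\<^bsub>S\<^esub> x = x"
    and grade_act:
      "\<lbrakk>a \<in> grade A m; x \<in> grade S n\<rbrakk> \<Longrightarrow> a \<odot>\<^bsub>S\<^esub> x \<in> grade S (m + n)"
    and delta_linear: "K_linear K A S (differential S)"
    and delta_grade: "x \<in> grade S n \<Longrightarrow> differential S x \<in> grade S (n + 1)"
    and delta_delta: "x \<in> carrier S \<Longrightarrow> differential S (differential S x) = \<zero>\<^bsub>S\<^esub>"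
    and delta_act:
      "\<lbrakk>a \<in> grade A m; x \<in> grade S n\<rbrakk> \<Longrightarrow>
        differential S (a \<odot>\<^bsub>S\<^esub> x) =
          differential A a \<odot>\<^bsub>S\<^esub> x \<oplus>\<^bsub>S\<^esub> signed S m (a \<odot>\<^bsub>S\<^esub> differential S x)"

definition dg_submodule ::
    "('k, 'a, 'm) dg_scheme \<Rightarrow> ('a, 's, 'n) dg_scheme \<Rightarrow> 's set \<Rightarrow> bool" where
  "dg_submodule A S N \<longleftrightarrow>
     graded_subgroup S N \<and>
     (\<forall>a\<in>carrier A. \<forall>x\<in>N. a \<odot>\<^bsub>S\<^esub> x \<in> N) \<and> (\<forall>x\<in>N. differential S x \<in> N)"

definition dg_simple ::
    "('k, 'l) ring_scheme \<Rightarrow> ('k, 'a, 'm) dg_scheme \<Rightarrow> ('a, 's, 'n) dg_scheme \<Rightarrow> bool" where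
  "dg_simple K A S \<longleftrightarrow>
     dg_left_module K A S \<and> carrier S \<noteq> {\<zero>\<^bsub>S\<^esub>} \<and>
     (\<forall>N. dg_submodule A S N \<longrightarrow> N = {\<zero>\<^bsub>S\<^esub>} \<or> N = carrier S)"

definition dg_left_ideal :: "('k, 'a, 'm) dg_scheme \<Rightarrow> 'a set \<Rightarrow> bool" where
  "dg_left_ideal A I \<longleftrightarrow>
     graded_subgroup A I \<and>
     (\<forall>a\<in>carrier A. \<forall>x\<in>I. a \<otimes>\<^bsub>A\<^esub> x \<in> I) \<and> (\<forall>x\<in>I. differential A x \<in> I)"

definition dg_right_ideal :: "('k, 'a, 'm) dg_scheme \<Rightarrow> 'a set \<Rightarrow> bool" where
  "dg_right_ideal A I \<longleftrightarrow>
     graded_subgroup A I \<and>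
     (\<forall>a\<in>carrier A. \<forall>x\<in>I. x \<otimes>\<^bsub>A\<^esub> a \<in> I) \<and> (\<forall>x\<in>I. differential A x \<in> I)"

definition dg_division_algebra ::
    "('k, 'l) ring_scheme \<Rightarrow> ('k, 'a, 'm) dg_scheme \<Rightarrow> bool" where
  "dg_division_algebra K A \<longleftrightarrow>
     dg_algebra K A \<and>
     (\<forall>I. dg_left_ideal A I \<longrightarrow> I = {\<zero>\<^bsub>A\<^esub>} \<or> I = carrier A) \<and>
     (\<forall>I. dg_right_ideal A I \<longrightarrow> I = {\<zero>\<^bsub>A\<^esub>} \<or> I = carrier A)"

text \<open>Maps on \<open>S\<close> are represented by functions that are \<^const>\<open>undefined\<close> outside the carrier,
  so that equality of functions is equality of maps.\<close>

definition Hom_deg ::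
    "('k, 'l) ring_scheme \<Rightarrow> ('k, 'a, 'm) dg_scheme \<Rightarrow> ('a, 's, 'n) dg_scheme
      \<Rightarrow> int \<Rightarrow> ('s \<Rightarrow> 's) set" where
  "Hom_deg K A S n =
     {f \<in> carrier S \<rightarrow>\<^sub>E carrier S.
        K_linear K A S f \<and>
        (\<forall>i. \<forall>x\<in>grade S i. f x \<in> grade S (i + n)) \<and>
        (\<forall>i. \<forall>a\<in>grade A i. \<forall>x\<in>carrier S. f (a \<odot>\<^bsub>S\<^esub> x) = signed S (i * n) (a \<odot>\<^bsub>S\<^esub> f x))}"

definition zero_map :: "('a, 's, 'n) dg_scheme \<Rightarrow> 's \<Rightarrow> 's" where
  "zero_map S = (\<lambda>x\<in>carrier S. \<zero>\<^bsub>S\<^esub>)"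

definition Hom_decomposes ::
    "('k, 'l) ring_scheme \<Rightarrow> ('k, 'a, 'm) dg_scheme \<Rightarrow> ('a, 's, 'n) dg_scheme
      \<Rightarrow> ('s \<Rightarrow> 's) \<Rightarrow> (int \<Rightarrow> 's \<Rightarrow> 's) \<Rightarrow> bool" where
  "Hom_decomposes K A S f c \<longleftrightarrow>
     (\<forall>n. c n \<in> Hom_deg K A S n) \<and> finite {n. c n \<noteq> zero_map S} \<and>
     f = (\<lambda>x\<in>carrier S. \<Oplus>\<^bsub>S\<^esub>n\<in>{n. c n \<noteq> zero_map S}. c n x)"

definition Hom_component ::
    "('k, 'l) ring_scheme \<Rightarrow> ('k, 'a, 'm) dg_scheme \<Rightarrow> ('a, 's, 'n) dg_scheme
      \<Rightarrow> ('s \<Rightarrow> 's) \<Rightarrow> int \<Rightarrow> 's \<Rightarrow> 's" where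
  "Hom_component K A S f = (THE c. Hom_decomposes K A S f c)"

text \<open>$d_{\mathrm{Hom}}$ is prescribed on homogeneous maps only; it is extended additively through
  the homogeneous components.\<close>

definition d_Hom ::
    "('k, 'l) ring_scheme \<Rightarrow> ('k, 'a, 'm) dg_scheme \<Rightarrow> ('a, 's, 'n) dg_scheme
      \<Rightarrow> ('s \<Rightarrow> 's) \<Rightarrow> 's \<Rightarrow> 's" where
  "d_Hom K A S f =
     (let c = Hom_component K A S f in
      (\<lambda>x\<in>carrier S. \<Oplus>\<^bsub>S\<^esub>n\<in>{n. c n \<noteq> zero_map S}.
        differential S (c n x) \<ominus>\<^bsub>S\<^esub> signed S n (c n (differential S x))))"

definition dg_End ::
    "('k, 'l) ring_scheme \<Rightarrow> ('k, 'a, 'm) dg_scheme \<Rightarrow> ('a, 's, 'n) dg_scheme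
      \<Rightarrow> ('k, 's \<Rightarrow> 's) dg" where
  "dg_End K A S =
     \<lparr>carrier = {f. \<exists>c. Hom_decomposes K A S f c},
      mult = compose (carrier S),
      one = (\<lambda>x\<in>carrier S. x),
      zero = zero_map S,
      add = (\<lambda>f g. \<lambda>x\<in>carrier S. f x \<oplus>\<^bsub>S\<^esub> g x),
      smult = (\<lambda>k f. \<lambda>x\<in>carrier S. scal A S k (f x)),
      grade = Hom_deg K A S,
      differential = d_Hom K A S\<rparr>"

definition dg_ker :: "('k, 'a, 'm) dg_scheme \<Rightarrow> ('k, 'a, 'm) dg_scheme" where
  "dg_ker A =
     A\<lparr>carrier := {x \<in> carrier A. differential A x = \<zero>\<^bsub>A\<^esub>},
       grade := (\<lambda>n. {x \<in> grade A n. differential A x = \<zero>\<^bsub>A\<^esub>})\<rparr>"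

definition right_regular :: "('a, 'm) ring_scheme \<Rightarrow> 'a \<Rightarrow> bool" where
  "right_regular R u \<longleftrightarrow> (\<forall>x\<in>carrier R. u \<otimes>\<^bsub>R\<^esub> x = \<zero>\<^bsub>R\<^esub> \<longrightarrow> x = \<zero>\<^bsub>R\<^esub>)"

definition left_regular :: "('a, 'm) ring_scheme \<Rightarrow> 'a \<Rightarrow> bool" where
  "left_regular R u \<longleftrightarrow> (\<forall>x\<in>carrier R. x \<otimes>\<^bsub>R\<^esub> u = \<zero>\<^bsub>R\<^esub> \<longrightarrow> x = \<zero>\<^bsub>R\<^esub>)"

end

theory Submission
  imports Defs
begin

text \<open>The kernel and the image of a homogeneous cycle \<open>u\<close> of the endomorphism dg-algebra are
  dg-submodules of \<open>S\<close>, so \<open>u \<noteq> 0\<close> is bijective and hence a unit. If \<open>x \<noteq> 0\<close> is a homogeneous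
  element of a one-sided dg-ideal, then either \<open>d x\<close> or \<open>x\<close> is a nonzero cycle in that ideal, which
  is therefore everything. For homogeneous cycles, left and right regularity both reduce to
  being nonzero.\<close>

section \<open>Graded groups and dg-algebras\<close>

text \<open>The differential of the endomorphism algebra is prescribed on homogeneous maps only,
  while its elements are finite sums of such maps. Uniqueness of components therefore has to be
  settled before \<open>d_Hom\<close> has any computable value; it is inherited from
  \<open>S\<close> by evaluating at homogeneous points. All sign identities are then verified for
  the graded commutator \<open>bracket n\<close> in a fixed degree and carried to sums by
  additivity.

  Kernel and image are dg-submodules because a cycle of degree n commutes with the differential of
  \<open>S\<close> up to the sign (-1)^n, and with a homogeneous scalar of degree i up to
  (-1)^(i*n). Bijectivity alone does not give a unit: the inverse map must again be a finite sum of
  homogeneous maps, and it is in fact homogeneous of degree -n. Zero fails to be regular because the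
  identity is a nonzero cycle; this rests on the unit of a dg-algebra having degree 0, which is
  derived from uniqueness of decompositions. The same fact makes the ground field act on modules in
  degree 0.\<close>

context abelian_group
begin

text \<open>Sorting a sum with \<open>a_ac\<close> can leave an element and its inverse apart. These
  rules cancel such a pair across one or two summands and finish the sign computations for
  brackets.\<close>

lemma add_minus_cancel:
  assumes "x \<in> carrier G" "y \<in> carrier G" "z \<in> carrier G"
  shows "x \<oplus> (y \<oplus> \<ominus> x) = y"
    and "x \<oplus> (y \<oplus> (\<ominus> x \<oplus> z)) = y \<oplus> z"
    and "x \<oplus> (y \<oplus> (z \<oplus> \<ominus> x)) = y \<oplus> z"
proof -
  have *: "x \<oplus> (w \<oplus> \<ominus> x) = w" if "w \<in> carrier G" for w
    using assms that a_comm[of w "\<ominus> x"] by (simp add: r_neg2)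
  show "x \<oplus> (y \<oplus> \<ominus> x) = y" using * assms by simp
  show "x \<oplus> (y \<oplus> (z \<oplus> \<ominus> x)) = y \<oplus> z" using *[of "y \<oplus> z"] assms by (simp add: a_assoc)
  then show "x \<oplus> (y \<oplus> (\<ominus> x \<oplus> z)) = y \<oplus> z" using assms a_comm[of z "\<ominus> x"] by simp
qed

lemma minus_zero_eq: "\<ominus> \<zero> = \<zero>"
  by simp

lemma minus_eq_zeroD:
  assumes "x \<ominus> y = \<zero>" "x \<in> carrier G" "y \<in> carrier G"
  shows "x = y"
  using minus_equality[of x "\<ominus> y"] assms by (simp add: minus_eq)

lemma signed_closed [simp]: "x \<in> carrier G \<Longrightarrow> signed G n x \<in> carrier G"
  by (simp add: signed_def)

lemma signed_zero [simp]: "signed G n \<zero> = \<zero>"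
  by (simp add: signed_def)

lemma signed_even [simp]: "even n \<Longrightarrow> signed G n x = x"
  by (simp add: signed_def)

lemma signed_signed:
  "x \<in> carrier G \<Longrightarrow> signed G m (signed G n x) = signed G (m + n) x"
  by (simp add: signed_def)

lemma signed_add:
  "\<lbrakk>x \<in> carrier G; y \<in> carrier G\<rbrakk> \<Longrightarrow> signed G n (x \<oplus> y) = signed G n x \<oplus> signed G n y"
  by (simp add: signed_def minus_add)

end

section \<open>Decompositions into homogeneous components\<close>

context graded_group
begin

lemma grade_closed: "x \<in> grade M n \<Longrightarrow> x \<in> carrier M"
  using additive_subgroup.a_Hcarr[OF grade_subgroup] .

lemma grade_zero [simp]: "\<zero> \<in> grade M n"
  using additive_subgroup.zero_closed[OF grade_subgroup] .

lemma grade_add: "\<lbrakk>x \<in> grade M n; y \<in> grade M n\<rbrakk> \<Longrightarrow> x \<oplus> y \<in> grade M n"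
  using additive_subgroup.a_closed[OF grade_subgroup] .

lemma grade_minus: "x \<in> grade M n \<Longrightarrow> \<ominus> x \<in> grade M n"
  using additive_subgroup.a_inv_closed[OF grade_subgroup] abelian_group_axioms by blast

lemma grade_signed: "x \<in> grade M n \<Longrightarrow> signed M m x \<in> grade M n"
  by (simp add: signed_def grade_minus)

text \<open>\<open>decomposes\<close> sums over the exact support. Any finite superset serves as
  well, since the extra terms vanish; this allows shifted index sets and components that happen to
  be zero.\<close>

lemma decomposesI:
  assumes "\<And>n. c n \<in> grade M n" "finite N" "\<And>n. n \<notin> N \<Longrightarrow> c n = \<zero>" "x = (\<Oplus>n\<in>N. c n)"
  shows "decomposes M x c"
proof -
  have sub: "{n. c n \<noteq> \<zero>} \<subseteq> N" using assms(3) by blast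
  have "(\<Oplus>n\<in>N. c n) = (\<Oplus>n\<in>{n. c n \<noteq> \<zero>}. c n)"
    by (rule add.finprod_mono_neutral_cong_right) (use assms sub grade_closed in blast)+
  then show ?thesis
    using assms finite_subset[OF sub] by (simp add: decomposes_def)
qed

lemma decomposesD:
  assumes "decomposes M x c"
  shows "c n \<in> grade M n" "finite {n. c n \<noteq> \<zero>}" "x = (\<Oplus>n\<in>{n. c n \<noteq> \<zero>}. c n)" "x \<in> carrier M"
proof -
  show *: "c n \<in> grade M n" "finite {n. c n \<noteq> \<zero>}" "x = (\<Oplus>n\<in>{n. c n \<noteq> \<zero>}. c n)" for n
    using assms by (auto simp: decomposes_def)
  show "x \<in> carrier M"
    by (subst *(3), rule finsum_closed) (use *(1) grade_closed in blast)
qed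

lemma decomposes_closed: "decomposes M x c \<Longrightarrow> c n \<in> carrier M"
  using decomposesD(1) grade_closed by blast

lemma decomposes_unique:
  "\<lbrakk>decomposes M x c; decomposes M x c'\<rbrakk> \<Longrightarrow> c = c'"
  using direct_sum[OF decomposesD(4)] by blast

lemma decomposes_homogeneous:
  assumes "x \<in> grade M n"
  shows "decomposes M x (\<lambda>i. if i = n then x else \<zero>)"
  by (rule decomposesI[where N = "{n}"]) (use assms grade_closed in auto)

text \<open>Every element is a finite sum of its components. Rules carrying a sign are available for
  homogeneous elements only, and this is how their consequences reach the whole carrier.\<close>

lemma graded_induct [consumes 1, case_names zero homogeneous add]:
  assumes "x \<in> carrier M"
    and zero: "P \<zero>"
    and homog: "\<And>n x. x \<in> grade M n \<Longrightarrow> P x"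
    and add: "\<And>x y. \<lbrakk>x \<in> carrier M; y \<in> carrier M; P x; P y\<rbrakk> \<Longrightarrow> P (x \<oplus> y)"
  shows "P x"
proof -
  obtain c where c: "decomposes M x c" using direct_sum[OF assms(1)] by blast
  have g: "c n \<in> grade M n" "c n \<in> carrier M" for n
    using decomposesD(1)[OF c] grade_closed by blast+
  have "P (\<Oplus>n\<in>N. c n)" if "finite N" for N
    using that
  proof induction
    case empty
    then show ?case using zero by simp
  next
    case (insert n N)
    then show ?case using homog[OF g(1)] g(2) add by simp
  qed
  then show ?thesis
    using decomposesD(2,3)[OF c] by simp
qed

end

section \<open>Units, cycles and one-sided dg-ideals in a dg-algebra\<close>

context dg_algebra
begin

text \<open>The degree 0 component \<open>e 0\<close> of the unit is itself a left identity: for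
  homogeneous \<open>a\<close>, expanding 1 in the product 1 * a gives a decomposition of
  \<open>a\<close>, and uniqueness leaves only the term of \<open>e 0\<close>.\<close>

lemma one_grade: "\<one>\<^bsub>A\<^esub> \<in> grade A 0"
proof -
  obtain e where e: "decomposes A \<one>\<^bsub>A\<^esub> e" using direct_sum[OF one_closed] by blast
  let ?N = "{n. e n \<noteq> \<zero>\<^bsub>A\<^esub>}"
  have eg: "e n \<in> grade A n" "e n \<in> carrier A" for n
    using decomposesD(1)[OF e] grade_closed by blast+
  have "e 0 \<otimes>\<^bsub>A\<^esub> a = a" if "a \<in> carrier A" for a
    using that
  proof (induction rule: graded_induct)
    case (homogeneous m a)
    \<comment> \<open>The product of \<open>e k\<close> and \<open>a\<close> has degree k + m, so
      the part in degree n comes from k = n - m.\<close>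
    let ?c = "\<lambda>n. e (n - m) \<otimes>\<^bsub>A\<^esub> a"
    have a: "a \<in> carrier A" using homogeneous grade_closed by blast
    have "decomposes A a ?c"
    proof (rule decomposesI)
      show "?c n \<in> grade A n" for n
        using grade_mult[OF eg(1)[of "n - m"] homogeneous] by simp
      show "finite ((\<lambda>n. n + m) ` ?N)" using decomposesD(2)[OF e] by simp
      show "?c n = \<zero>\<^bsub>A\<^esub>" if "n \<notin> (\<lambda>n. n + m) ` ?N" for n
      proof -
        have "e (n - m) = \<zero>\<^bsub>A\<^esub>"
          using that by (auto simp: image_iff dest: spec[of _ "n - m"])
        then show ?thesis using a by simp
      qed
      have "a = \<one>\<^bsub>A\<^esub> \<otimes>\<^bsub>A\<^esub> a" using a by simp
      also have "\<dots> = (\<Oplus>\<^bsub>A\<^esub>n\<in>?N. e n) \<otimes>\<^bsub>A\<^esub> a"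
        using decomposesD(3)[OF e] by simp
      also have "\<dots> = (\<Oplus>\<^bsub>A\<^esub>n\<in>?N. e n \<otimes>\<^bsub>A\<^esub> a)"
        using decomposesD(2)[OF e] eg a by (simp add: finsum_ldistr Pi_def)
      also have "\<dots> = (\<Oplus>\<^bsub>A\<^esub>n\<in>(\<lambda>n. n + m) ` ?N. ?c n)"
        using eg a by (subst add.finprod_reindex) (auto simp: inj_on_def)
      finally show "a = (\<Oplus>\<^bsub>A\<^esub>n\<in>(\<lambda>n. n + m) ` ?N. ?c n)" .
    qed
    \<comment> \<open>At index m the two decompositions of \<open>a\<close> read \<open>e 0\<close>
      times \<open>a\<close> and \<open>a\<close>.\<close>
    from fun_cong[OF decomposes_unique[OF this decomposes_homogeneous[OF homogeneous]], of m]
    show ?case by simp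
  qed (use eg in \<open>simp_all add: r_distr\<close>)
  \<comment> \<open>A left identity multiplied by the unit is the unit.\<close>
  from this[OF one_closed] have "e 0 = \<one>\<^bsub>A\<^esub>" using eg by simp
  then show ?thesis using eg(1)[of 0] by simp
qed

lemma diff_closed: "a \<in> carrier A \<Longrightarrow> differential A a \<in> carrier A"
proof (induction rule: graded_induct)
  case zero
  then show ?case using diff_grade[of "\<zero>\<^bsub>A\<^esub>" 0] grade_closed grade_zero by blast
next
  case (homogeneous n x)
  then show ?case using diff_grade grade_closed by blast
qed (simp add: diff_add)

text \<open>The Leibniz rule for 1 = 1 * 1 carries no sign in degree 0 and gives d(1) = d(1) +
  d(1).\<close>

lemma diff_one: "differential A \<one>\<^bsub>A\<^esub> = \<zero>\<^bsub>A\<^esub>"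
  using diff_mult[OF one_grade one_grade] diff_closed[OF one_closed]
  by (simp add: add.l_cancel_one')

text \<open>Gradedness puts a nonzero component of some element into \<open>I\<close>, and d^2 = 0
  turns it or its differential into the required cycle. Multiplication does not enter, so the
  argument serves left and right ideals alike.\<close>

lemma nonzero_cycle_exists:
  assumes "graded_subgroup A I" "\<forall>x\<in>I. differential A x \<in> I" "I \<noteq> {\<zero>\<^bsub>A\<^esub>}"
  obtains u n where "u \<in> I" "u \<in> grade A n" "u \<noteq> \<zero>\<^bsub>A\<^esub>" "differential A u = \<zero>\<^bsub>A\<^esub>"
proof -
  have "\<zero>\<^bsub>A\<^esub> \<in> I"
    using assms(1) additive_subgroup.zero_closed unfolding graded_subgroup_def by blast
  then obtain x where x: "x \<in> I" "x \<noteq> \<zero>\<^bsub>A\<^esub>" using assms(3) by blast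
  then obtain c where c: "\<And>n. c n \<in> I" "decomposes A x c"
    using assms(1) unfolding graded_subgroup_def by blast
  obtain n where n: "c n \<noteq> \<zero>\<^bsub>A\<^esub>"
  proof (rule ccontr)
    assume "\<not> thesis"
    then have "{n. c n \<noteq> \<zero>\<^bsub>A\<^esub>} = {}" using that by blast
    then show False using decomposesD(3)[OF c(2)] x(2) by simp
  qed
  have g: "c n \<in> grade A n" using decomposesD(1)[OF c(2)] .
  show ?thesis
  proof (cases "differential A (c n) = \<zero>\<^bsub>A\<^esub>")
    case True
    then show ?thesis using that c(1) g n by blast
  next
    case False
    moreover have "differential A (differential A (c n)) = \<zero>\<^bsub>A\<^esub>"
      using g grade_closed diff_diff by blast
    ultimately show ?thesis using that assms(2) c(1) diff_grade[OF g] by blast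
  qed
qed

text \<open>A unit u in an ideal absorbs everything: a = (a u^-1) u on the left side and a = u (u^-1
  a) on the right side.\<close>

lemma dg_division_algebraI:
  assumes inv: "\<And>u n. \<lbrakk>u \<in> grade A n; u \<noteq> \<zero>\<^bsub>A\<^esub>; differential A u = \<zero>\<^bsub>A\<^esub>\<rbrakk> \<Longrightarrow> u \<in> Units A"
  shows "dg_division_algebra K A"
proof -
  have "I = carrier A" if I: "dg_left_ideal A I" "I \<noteq> {\<zero>\<^bsub>A\<^esub>}" for I
  proof -
    have grd: "graded_subgroup A I" and d: "\<forall>x\<in>I. differential A x \<in> I"
      and mult: "\<And>a x. \<lbrakk>a \<in> carrier A; x \<in> I\<rbrakk> \<Longrightarrow> a \<otimes>\<^bsub>A\<^esub> x \<in> I"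
      using I(1) by (auto simp: dg_left_ideal_def)
    obtain u where u: "u \<in> I" "u \<in> Units A"
      using nonzero_cycle_exists[OF grd d I(2)] inv by metis
    have "a \<in> I" if a: "a \<in> carrier A" for a
      using mult[of "a \<otimes>\<^bsub>A\<^esub> inv\<^bsub>A\<^esub> u" u] u a by (simp add: m_assoc Units_closed)
    then show ?thesis
      using grd additive_subgroup.a_subset unfolding graded_subgroup_def by blast
  qed
  moreover have "I = carrier A" if I: "dg_right_ideal A I" "I \<noteq> {\<zero>\<^bsub>A\<^esub>}" for I
  proof -
    have grd: "graded_subgroup A I" and d: "\<forall>x\<in>I. differential A x \<in> I"
      and mult: "\<And>a x. \<lbrakk>a \<in> carrier A; x \<in> I\<rbrakk> \<Longrightarrow> x \<otimes>\<^bsub>A\<^esub> a \<in> I"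
      using I(1) by (auto simp: dg_right_ideal_def)
    obtain u where u: "u \<in> I" "u \<in> Units A"
      using nonzero_cycle_exists[OF grd d I(2)] inv by metis
    have "a \<in> I" if a: "a \<in> carrier A" for a
      using mult[of "inv\<^bsub>A\<^esub> u \<otimes>\<^bsub>A\<^esub> a" u] u a by (simp add: Units_closed flip: m_assoc)
    then show ?thesis
      using grd additive_subgroup.a_subset unfolding graded_subgroup_def by blast
  qed
  ultimately show ?thesis
    using dg_algebra_axioms unfolding dg_division_algebra_def by blast
qed

text \<open>Regularity is tested against cycles only, but the cancellation takes place in
  \<open>A\<close>, where a nonzero homogeneous cycle has an inverse.\<close>

lemma regular_cycle_iff:
  assumes inv: "\<And>u n. \<lbrakk>u \<in> grade A n; u \<noteq> \<zero>\<^bsub>A\<^esub>; differential A u = \<zero>\<^bsub>A\<^esub>\<rbrakk> \<Longrightarrow> u \<in> Units A"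
    and one: "\<one>\<^bsub>A\<^esub> \<noteq> \<zero>\<^bsub>A\<^esub>"
    and u: "u \<in> homogeneous (dg_ker A)"
  shows "left_regular (dg_ker A) u \<longleftrightarrow> u \<noteq> \<zero>\<^bsub>A\<^esub>"
    and "right_regular (dg_ker A) u \<longleftrightarrow> u \<noteq> \<zero>\<^bsub>A\<^esub>"
proof -
  obtain n where n: "u \<in> grade A n" "differential A u = \<zero>\<^bsub>A\<^esub>"
    using u by (auto simp: homogeneous_def dg_ker_def)
  show "left_regular (dg_ker A) u \<longleftrightarrow> u \<noteq> \<zero>\<^bsub>A\<^esub>"
  proof
    \<comment> \<open>The test element is the unit, a cycle by \<open>diff_one\<close>: for u = 0
      its product with u vanishes although it is nonzero.\<close>
    show "u \<noteq> \<zero>\<^bsub>A\<^esub>" if "left_regular (dg_ker A) u"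
      using that one diff_one by (auto simp: left_regular_def dg_ker_def)
    assume "u \<noteq> \<zero>\<^bsub>A\<^esub>"
    then have "u \<in> Units A" using inv n by blast
    then have "x = \<zero>\<^bsub>A\<^esub>" if "x \<in> carrier A" "x \<otimes>\<^bsub>A\<^esub> u = \<zero>\<^bsub>A\<^esub>" for x
      using that m_assoc[of x u "inv\<^bsub>A\<^esub> u"] by (simp add: Units_closed)
    then show "left_regular (dg_ker A) u" by (auto simp: left_regular_def dg_ker_def)
  qed
  show "right_regular (dg_ker A) u \<longleftrightarrow> u \<noteq> \<zero>\<^bsub>A\<^esub>"
  proof
    show "u \<noteq> \<zero>\<^bsub>A\<^esub>" if "right_regular (dg_ker A) u"
      using that one diff_one by (auto simp: right_regular_def dg_ker_def)
    assume "u \<noteq> \<zero>\<^bsub>A\<^esub>"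
    then have "u \<in> Units A" using inv n by blast
    then have "x = \<zero>\<^bsub>A\<^esub>" if "x \<in> carrier A" "u \<otimes>\<^bsub>A\<^esub> x = \<zero>\<^bsub>A\<^esub>" for x
      using that m_assoc[of "inv\<^bsub>A\<^esub> u" u x] by (simp add: Units_closed)
    then show "right_regular (dg_ker A) u" by (auto simp: right_regular_def dg_ker_def)
  qed
qed

end

section \<open>Homogeneous maps of a dg-module\<close>

context dg_left_module
begin

abbreviation End :: "('a, 'e \<Rightarrow> 'e) dg" where
  "End \<equiv> dg_End K A S"

abbreviation H :: "int \<Rightarrow> ('e \<Rightarrow> 'e) set" where
  "H \<equiv> Hom_deg K A S"

lemma scal_closed: "\<lbrakk>k \<in> carrier K; x \<in> carrier S\<rbrakk> \<Longrightarrow> scal A S k x \<in> carrier S"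
  by (simp add: scal_def act_closed A.smult_closed)

text \<open>The element k * 1 is central in \<open>A\<close>, because scalars pass through products
  on either side.\<close>

lemma scal_act:
  assumes "k \<in> carrier K" "a \<in> carrier A" "x \<in> carrier S"
  shows "a \<odot>\<^bsub>S\<^esub> scal A S k x = scal A S k (a \<odot>\<^bsub>S\<^esub> x)"
proof -
  let ?k = "k \<odot>\<^bsub>A\<^esub> \<one>\<^bsub>A\<^esub>"
  have "a \<otimes>\<^bsub>A\<^esub> ?k = ?k \<otimes>\<^bsub>A\<^esub> a"
    using assms by (simp add: A.smult_mult_left A.smult_mult_right)
  then show ?thesis
    using assms by (simp add: scal_def act_assoc[symmetric] A.smult_closed)
qed

text \<open>A scalar acts as k * 1, which has degree 0 by \<open>one_grade\<close>.\<close>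

lemma scal_grade: "\<lbrakk>k \<in> carrier K; x \<in> grade S n\<rbrakk> \<Longrightarrow> scal A S k x \<in> grade S n"
  using grade_act[OF A.grade_smult[OF _ A.one_grade], of k x n] by (simp add: scal_def)

section \<open>Closure properties of linear maps\<close>

lemma K_linearD:
  assumes "K_linear K A S f"
  shows "x \<in> carrier S \<Longrightarrow> f x \<in> carrier S"
    and "\<lbrakk>x \<in> carrier S; y \<in> carrier S\<rbrakk> \<Longrightarrow> f (x \<oplus>\<^bsub>S\<^esub> y) = f x \<oplus>\<^bsub>S\<^esub> f y"
    and "\<lbrakk>k \<in> carrier K; x \<in> carrier S\<rbrakk> \<Longrightarrow> f (scal A S k x) = scal A S k (f x)"
  using assms by (auto simp: K_linear_def)

lemma K_linear_zero:
  assumes "K_linear K A S f" shows "f \<zero>\<^bsub>S\<^esub> = \<zero>\<^bsub>S\<^esub>"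
  using K_linearD(1)[OF assms, of "\<zero>\<^bsub>S\<^esub>"] K_linearD(2)[OF assms, of "\<zero>\<^bsub>S\<^esub>" "\<zero>\<^bsub>S\<^esub>"]
  by simp

lemma K_linear_minus:
  assumes "K_linear K A S f" "x \<in> carrier S"
  shows "f (\<ominus>\<^bsub>S\<^esub> x) = \<ominus>\<^bsub>S\<^esub> f x"
proof (rule S.minus_equality[symmetric])
  show "f (\<ominus>\<^bsub>S\<^esub> x) \<oplus>\<^bsub>S\<^esub> f x = \<zero>\<^bsub>S\<^esub>"
    using assms K_linearD(2)[OF assms(1), of "\<ominus>\<^bsub>S\<^esub> x" x]
    by (simp add: S.l_neg K_linear_zero)
qed (use assms K_linearD(1) in auto)

lemma K_linear_signed:
  "\<lbrakk>K_linear K A S f; x \<in> carrier S\<rbrakk> \<Longrightarrow> f (signed S n x) = signed S n (f x)"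
  by (simp add: signed_def K_linear_minus)

lemma K_linear_finsum:
  assumes "K_linear K A S f" "finite N" "\<And>n. c n \<in> carrier S"
  shows "f (\<Oplus>\<^bsub>S\<^esub>n\<in>N. c n) = (\<Oplus>\<^bsub>S\<^esub>n\<in>N. f (c n))"
  using assms(2)
proof induction
  case empty
  then show ?case using assms(1) by (simp add: K_linear_zero)
next
  case (insert n N)
  then show ?case using assms(3) K_linearD(1,2)[OF assms(1)] by (simp add: Pi_def)
qed

lemma K_linear_act: "a \<in> carrier A \<Longrightarrow> K_linear K A S (\<lambda>x. a \<odot>\<^bsub>S\<^esub> x)"
  by (simp add: K_linear_def act_closed act_r_distr scal_act)

lemma K_linear_scal: "k \<in> carrier K \<Longrightarrow> K_linear K A S (scal A S k)"
  using K_linear_act[of "k \<odot>\<^bsub>A\<^esub> \<one>\<^bsub>A\<^esub>"] by (simp add: scal_def[abs_def] A.smult_closed)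

lemma K_linear_id: "K_linear K A S (\<lambda>x. x)"
  by (simp add: K_linear_def)

lemma K_linear_zero_fun: "K_linear K A S (\<lambda>x. \<zero>\<^bsub>S\<^esub>)"
  by (simp add: K_linear_def K_linear_zero[OF K_linear_scal])

lemma K_linear_add:
  assumes "K_linear K A S f" "K_linear K A S g"
  shows "K_linear K A S (\<lambda>x. f x \<oplus>\<^bsub>S\<^esub> g x)"
  using K_linearD[OF assms(1)] K_linearD[OF assms(2)]
  by (auto simp: K_linear_def K_linearD[OF K_linear_scal] S.a_ac)

lemma K_linear_comp:
  "\<lbrakk>K_linear K A S f; K_linear K A S g\<rbrakk> \<Longrightarrow> K_linear K A S (\<lambda>x. f (g x))"
  by (auto simp: K_linear_def Pi_def)

lemma K_linear_uminus: "K_linear K A S (\<lambda>x. \<ominus>\<^bsub>S\<^esub> x)"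
  by (simp add: K_linear_def S.minus_add K_linear_minus[OF K_linear_scal])

lemma K_linear_signed_fun: "K_linear K A S (signed S n)"
  using K_linear_id K_linear_uminus by (cases "even n") (simp_all add: signed_def[abs_def])

text \<open>Linearity only evaluates a map on the carrier, so the closure rules for plain functions
  also apply to the restricted functions that represent elements of \<open>End\<close>.\<close>

lemma K_linear_restrict:
  "K_linear K A S (restrict f (carrier S)) \<longleftrightarrow> K_linear K A S f"
  by (auto simp: K_linear_def scal_closed Pi_def)

lemmas delta_closed = K_linearD(1)[OF delta_linear]

section \<open>Homogeneous maps obeying the sign rule\<close>

lemma Hom_degI:
  assumes "f \<in> extensional (carrier S)" "K_linear K A S f"
    and "\<And>i x. x \<in> grade S i \<Longrightarrow> f x \<in> grade S (i + n)"
    and "\<And>i a x. \<lbrakk>a \<in> grade A i; x \<in> carrier S\<rbrakk> \<Longrightarrow>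
           f (a \<odot>\<^bsub>S\<^esub> x) = signed S (i * n) (a \<odot>\<^bsub>S\<^esub> f x)"
  shows "f \<in> H n"
  using assms K_linearD(1)[OF assms(2)] by (simp add: Hom_deg_def PiE_def)

lemma Hom_degD:
  assumes "f \<in> H n"
  shows "f \<in> extensional (carrier S)" "K_linear K A S f"
    and "x \<in> grade S i \<Longrightarrow> f x \<in> grade S (i + n)"
    and "\<lbrakk>a \<in> grade A i; x \<in> carrier S\<rbrakk> \<Longrightarrow>
           f (a \<odot>\<^bsub>S\<^esub> x) = signed S (i * n) (a \<odot>\<^bsub>S\<^esub> f x)"
    and "x \<in> carrier S \<Longrightarrow> f x \<in> carrier S"
  using assms by (auto simp: Hom_deg_def PiE_def)

lemma Hom_deg_zero: "zero_map S \<in> H n"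
  unfolding zero_map_def
  by (rule Hom_degI)
    (auto simp: K_linear_restrict K_linear_zero_fun act_closed A.grade_closed S.grade_closed
      S.grade_zero K_linear_zero[OF K_linear_act])

lemma Hom_deg_id: "(\<lambda>x\<in>carrier S. x) \<in> H 0"
  by (rule Hom_degI)
    (auto simp: K_linear_restrict K_linear_id act_closed A.grade_closed S.grade_closed)

lemma Hom_deg_add:
  assumes "f \<in> H n" "g \<in> H n"
  shows "(\<lambda>x\<in>carrier S. f x \<oplus>\<^bsub>S\<^esub> g x) \<in> H n"
  by (rule Hom_degI)
    (auto simp: K_linear_restrict K_linear_add act_closed A.grade_closed S.grade_closed
      S.grade_add S.signed_add act_r_distr Hom_degD[OF assms(1)] Hom_degD[OF assms(2)])

lemma Hom_deg_minus:
  assumes "f \<in> H n"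
  shows "(\<lambda>x\<in>carrier S. \<ominus>\<^bsub>S\<^esub> f x) \<in> H n"
  by (rule Hom_degI)
    (auto simp: K_linear_restrict K_linear_comp[OF K_linear_uminus] act_closed A.grade_closed
      S.grade_closed S.grade_minus K_linear_minus[OF K_linear_signed_fun, symmetric]
      K_linear_minus[OF K_linear_act] Hom_degD[OF assms(1)])

lemma Hom_deg_scal:
  assumes "f \<in> H n" "k \<in> carrier K"
  shows "(\<lambda>x\<in>carrier S. scal A S k (f x)) \<in> H n"
  by (rule Hom_degI)
    (auto simp: K_linear_restrict K_linear_comp[OF K_linear_scal] act_closed A.grade_closed
      S.grade_closed scal_grade K_linear_signed[OF K_linear_scal] scal_act
      Hom_degD[OF assms(1)] assms(2))

lemma Hom_deg_comp:
  assumes f: "f \<in> H m" and g: "g \<in> H n"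
  shows "compose (carrier S) f g \<in> H (m + n)"
proof (rule Hom_degI)
  fix i x assume "x \<in> grade S i"
  then have "f (g x) \<in> grade S (i + n + m)"
    using f g by (simp add: Hom_degD(3))
  then show "compose (carrier S) f g x \<in> grade S (i + (m + n))"
    using \<open>x \<in> grade S i\<close> by (simp add: compose_def S.grade_closed ac_simps)
next
  fix i a x assume ax: "a \<in> grade A i" "x \<in> carrier S"
  then have "f (g (a \<odot>\<^bsub>S\<^esub> x)) = signed S (i * n) (signed S (i * m) (a \<odot>\<^bsub>S\<^esub> f (g x)))"
    using f g by (simp add: Hom_degD K_linear_signed act_closed A.grade_closed)
  with ax show "compose (carrier S) f g (a \<odot>\<^bsub>S\<^esub> x) =
      signed S (i * (m + n)) (a \<odot>\<^bsub>S\<^esub> compose (carrier S) f g x)"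
    by (simp add: compose_def act_closed A.grade_closed S.signed_signed Hom_degD(5)[OF f]
        Hom_degD(5)[OF g] algebra_simps)
qed (use f g in \<open>simp_all add: compose_def K_linear_restrict K_linear_comp Hom_degD(2)\<close>)

text \<open>The graded commutator with the differential of \<open>S\<close>. The degree is an
  explicit argument because a map does not determine it: the zero map lies in every degree.\<close>

definition bracket :: "int \<Rightarrow> ('e \<Rightarrow> 'e) \<Rightarrow> 'e \<Rightarrow> 'e" where
  "bracket n f = (\<lambda>x\<in>carrier S.
     differential S (f x) \<ominus>\<^bsub>S\<^esub> signed S n (f (differential S x)))"

text \<open>In the sign rule for the commutator both of its halves produce a term with the
  differential of \<open>a\<close>; these have equal signs before the subtraction and cancel,
  leaving (-1)^(i*(n+1)) in front.\<close>

lemma Hom_deg_bracket: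
  assumes f: "f \<in> H n"
  shows "bracket n f \<in> H (n + 1)"
proof -
  have lin: "K_linear K A S (bracket n f)"
    unfolding bracket_def K_linear_restrict S.minus_eq
    by (intro K_linear_add K_linear_comp[OF K_linear_uminus]
        K_linear_comp[OF K_linear_signed_fun] K_linear_comp[OF delta_linear]
        K_linear_comp[OF _ delta_linear] Hom_degD(2)[OF f])
  show ?thesis
  proof (rule Hom_degI)
    show "K_linear K A S (bracket n f)" by (rule lin)
  next
    fix i x assume x: "x \<in> grade S i"
    have "f (differential S x) \<in> grade S (i + (n + 1))"
      using Hom_degD(3)[OF f delta_grade[OF x]] by (simp add: ac_simps)
    moreover have "differential S (f x) \<in> grade S (i + (n + 1))"
      using delta_grade[OF Hom_degD(3)[OF f x]] by (simp add: ac_simps)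
    ultimately show "bracket n f x \<in> grade S (i + (n + 1))"
      using x by (simp add: bracket_def S.grade_closed S.minus_eq S.grade_add S.grade_minus S.grade_signed)
  next
    fix i a x assume a: "a \<in> grade A i" and x: "x \<in> carrier S"
    \<comment> \<open>The Leibniz rule \<open>delta_act\<close> needs a homogeneous argument,
      whereas the sign rule is demanded on the whole carrier; hence the induction over
      \<open>x\<close>.\<close>
    let ?P = "\<lambda>x. bracket n f (a \<odot>\<^bsub>S\<^esub> x) = signed S (i * (n + 1)) (a \<odot>\<^bsub>S\<^esub> bracket n f x)"
    have aA: "a \<in> carrier A" "differential A a \<in> carrier A"
      using a A.grade_closed A.diff_closed by blast+
    show "?P x"
      using x
    proof (induction rule: S.graded_induct)
      case zero
      then show ?case
        using lin aA by (simp add: K_linear_zero K_linear_zero[OF K_linear_act])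
    next
      case (homogeneous j x)
      then have x: "x \<in> carrier S" "f x \<in> carrier S" "differential S x \<in> carrier S"
          "f (differential S x) \<in> carrier S" "differential S (f x) \<in> carrier S"
        using S.grade_closed delta_closed Hom_degD(5)[OF f] by blast+
      \<comment> \<open>These are the only three terms that occur. The coefficients of
        \<open>p\<close> are (-1)^(i*n) and (-1)^n (-1)^((i+1)*n), which agree, so \<open>p\<close>
        drops out of the difference.\<close>
      define p q r where pqr: "p = differential A a \<odot>\<^bsub>S\<^esub> f x"
        "q = a \<odot>\<^bsub>S\<^esub> differential S (f x)" "r = a \<odot>\<^bsub>S\<^esub> f (differential S x)"
      have c: "p \<in> carrier S" "q \<in> carrier S" "r \<in> carrier S"
        using aA x act_closed by (auto simp: pqr)
      have "differential S (f (a \<odot>\<^bsub>S\<^esub> x)) = signed S (i * n) (p \<oplus>\<^bsub>S\<^esub> signed S i q)"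
        using a aA x delta_act[OF a Hom_degD(3)[OF f homogeneous]]
        by (simp add: Hom_degD(4)[OF f a] K_linear_signed[OF delta_linear] act_closed pqr)
      moreover have "f (differential S (a \<odot>\<^bsub>S\<^esub> x)) =
          signed S ((i + 1) * n) p \<oplus>\<^bsub>S\<^esub> signed S i (signed S (i * n) r)"
        using a aA x delta_act[OF a homogeneous] Hom_degD(4)[OF f A.diff_grade[OF a]]
        by (simp add: Hom_degD(4)[OF f a] K_linear_signed[OF Hom_degD(2)[OF f]] act_closed pqr
            K_linearD(2)[OF Hom_degD(2)[OF f]])
      moreover have "a \<odot>\<^bsub>S\<^esub> bracket n f x = q \<ominus>\<^bsub>S\<^esub> signed S n r"
        using aA x by (simp add: bracket_def S.minus_eq act_r_distr pqr
            K_linear_minus[OF K_linear_act] K_linear_signed[OF K_linear_act])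
      ultimately show ?case
        using aA x c by (cases "even n"; cases "even i")
          (simp_all add: bracket_def act_closed signed_def S.minus_eq S.minus_add S.a_ac
            S.add_minus_cancel)
    next
      case (add x y)
      then show ?case
        using aA by (simp add: act_r_distr act_closed K_linearD[OF lin] S.signed_add)
    qed
  qed (simp add: bracket_def)
qed

subsection \<open>The endomorphism dg-algebra\<close>

lemma End_simps:
  "carrier End = {f. \<exists>c. Hom_decomposes K A S f c}"
  "f \<otimes>\<^bsub>End\<^esub> g = compose (carrier S) f g"
  "\<one>\<^bsub>End\<^esub> = (\<lambda>x\<in>carrier S. x)"
  "\<zero>\<^bsub>End\<^esub> = zero_map S"
  "f \<oplus>\<^bsub>End\<^esub> g = (\<lambda>x\<in>carrier S. f x \<oplus>\<^bsub>S\<^esub> g x)"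
  "k \<odot>\<^bsub>End\<^esub> f = (\<lambda>x\<in>carrier S. scal A S k (f x))"
  "grade End = H"
  "differential End = d_Hom K A S"
  by (simp_all add: dg_End_def)

lemma zero_map_apply [simp]: "x \<in> carrier S \<Longrightarrow> zero_map S x = \<zero>\<^bsub>S\<^esub>"
  by (simp add: zero_map_def)

text \<open>Enlarging the support to any finite index set lets several maps be expanded over one
  common set.\<close>

lemma Hom_decomposes_sum:
  assumes "Hom_decomposes K A S f c" "finite N" "\<And>n. n \<notin> N \<Longrightarrow> c n = zero_map S"
    and "x \<in> carrier S"
  shows "f x = (\<Oplus>\<^bsub>S\<^esub>n\<in>N. c n x)"
proof -
  have c: "c n \<in> H n" for n using assms(1) by (simp add: Hom_decomposes_def)
  have sub: "{n. c n \<noteq> zero_map S} \<subseteq> N" using assms(3) by blast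
  have "(\<Oplus>\<^bsub>S\<^esub>n\<in>N. c n x) = (\<Oplus>\<^bsub>S\<^esub>n\<in>{n. c n \<noteq> zero_map S}. c n x)"
    by (rule S.add.finprod_mono_neutral_cong_right)
      (use assms(2,4) sub Hom_degD(5)[OF c] in auto)
  then show ?thesis using assms(1,4) by (simp add: Hom_decomposes_def)
qed

lemma Hom_decomposesI:
  assumes "\<And>n. c n \<in> H n" "finite N" "\<And>n. n \<notin> N \<Longrightarrow> c n = zero_map S"
    and "f \<in> extensional (carrier S)" "\<And>x. x \<in> carrier S \<Longrightarrow> f x = (\<Oplus>\<^bsub>S\<^esub>n\<in>N. c n x)"
  shows "Hom_decomposes K A S f c"
proof -
  have sub: "{n. c n \<noteq> zero_map S} \<subseteq> N" using assms(3) by blast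
  have "f = (\<lambda>x\<in>carrier S. \<Oplus>\<^bsub>S\<^esub>n\<in>{n. c n \<noteq> zero_map S}. c n x)"
  proof (rule extensionalityI[where A = "carrier S"])
    fix x assume x: "x \<in> carrier S"
    have "(\<Oplus>\<^bsub>S\<^esub>n\<in>N. c n x) = (\<Oplus>\<^bsub>S\<^esub>n\<in>{n. c n \<noteq> zero_map S}. c n x)"
      by (rule S.add.finprod_mono_neutral_cong_right)
        (use assms(2) x sub Hom_degD(5)[OF assms(1)] in auto)
    then show "f x = (\<lambda>x\<in>carrier S. \<Oplus>\<^bsub>S\<^esub>n\<in>{n. c n \<noteq> zero_map S}. c n x) x"
      using x assms(5) by simp
  qed (use assms(4) in auto)
  then show ?thesis
    using assms(1) finite_subset[OF sub assms(2)] by (simp add: Hom_decomposes_def)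
qed

lemma Hom_decomposesD:
  assumes "Hom_decomposes K A S f c"
  shows "c n \<in> H n" "finite {n. c n \<noteq> zero_map S}" "f \<in> extensional (carrier S)"
    and "x \<in> carrier S \<Longrightarrow> f x \<in> carrier S"
proof -
  show c: "c n \<in> H n" "finite {n. c n \<noteq> zero_map S}" "f \<in> extensional (carrier S)" for n
    using assms by (auto simp: Hom_decomposes_def)
  assume "x \<in> carrier S"
  then show "f x \<in> carrier S"
    using Hom_decomposes_sum[OF assms c(2)] Hom_degD(5)[OF c(1)]
    by (auto intro!: S.finsum_closed)
qed

text \<open>Components may cancel, so the support of the sum can be smaller than the union of
  supports; \<open>Hom_decomposesI\<close> tolerates the surplus indices.\<close>

lemma Hom_decomposes_add:
  assumes f: "Hom_decomposes K A S f c" and g: "Hom_decomposes K A S g c'"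
  shows "Hom_decomposes K A S (f \<oplus>\<^bsub>End\<^esub> g) (\<lambda>n. c n \<oplus>\<^bsub>End\<^esub> c' n)"
proof (rule Hom_decomposesI)
  let ?N = "{n. c n \<noteq> zero_map S} \<union> {n. c' n \<noteq> zero_map S}"
  show fin: "finite ?N" using Hom_decomposesD(2) f g by auto
  show "c n \<oplus>\<^bsub>End\<^esub> c' n \<in> H n" for n
    using Hom_decomposesD(1)[OF f] Hom_decomposesD(1)[OF g] by (simp add: End_simps Hom_deg_add)
  show "c n \<oplus>\<^bsub>End\<^esub> c' n = zero_map S" if "n \<notin> ?N" for n
    using that by (auto simp: End_simps zero_map_def)
  show "(f \<oplus>\<^bsub>End\<^esub> g) x = (\<Oplus>\<^bsub>S\<^esub>n\<in>?N. (c n \<oplus>\<^bsub>End\<^esub> c' n) x)" if x: "x \<in> carrier S" for x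
    using x Hom_decomposes_sum[OF f fin _ x] Hom_decomposes_sum[OF g fin _ x]
      Hom_degD(5)[OF Hom_decomposesD(1)[OF f] x] Hom_degD(5)[OF Hom_decomposesD(1)[OF g] x]
    by (simp add: End_simps S.finsum_addf)
qed (simp add: End_simps)

lemma Hom_deg_carrier: "f \<in> H n \<Longrightarrow> f \<in> carrier End"
  unfolding End_simps
  by (rule CollectI, rule exI[of _ "\<lambda>i. if i = n then f else zero_map S"],
      rule Hom_decomposesI[where N = "{n}"])
    (auto simp: Hom_deg_zero Hom_degD)

lemma End_carrierD:
  assumes "f \<in> carrier End"
  shows "f \<in> extensional (carrier S)" "x \<in> carrier S \<Longrightarrow> f x \<in> carrier S"
  using assms Hom_decomposesD(3,4) by (auto simp: End_simps)

lemma End_eqI: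
  "\<lbrakk>f \<in> extensional (carrier S); g \<in> extensional (carrier S);
    \<And>x. x \<in> carrier S \<Longrightarrow> f x = g x\<rbrakk> \<Longrightarrow> f = g"
  by (rule extensionalityI)

text \<open>Membership in the carrier means possessing a decomposition, so closure is proved by
  adding or negating components degree by degree.\<close>

lemma End_abelian_group: "abelian_group End"
proof (rule abelian_groupI)
  show "f \<oplus>\<^bsub>End\<^esub> g \<in> carrier End" if "f \<in> carrier End" "g \<in> carrier End" for f g
    using that Hom_decomposes_add unfolding End_simps(1) by blast
  show "\<zero>\<^bsub>End\<^esub> \<in> carrier End"
    using Hom_deg_carrier[OF Hom_deg_zero] by (simp add: End_simps)
  show "\<exists>g\<in>carrier End. g \<oplus>\<^bsub>End\<^esub> f = \<zero>\<^bsub>End\<^esub>" if f: "f \<in> carrier End" for f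
  proof -
    obtain c where c: "Hom_decomposes K A S f c" using f by (auto simp: End_simps)
    let ?N = "{n. c n \<noteq> zero_map S}"
    let ?m = "\<lambda>f. \<lambda>x\<in>carrier S. \<ominus>\<^bsub>S\<^esub> f x"
    note cn = Hom_degD(5)[OF Hom_decomposesD(1)[OF c]]
    have "Hom_decomposes K A S (?m f) (\<lambda>n. ?m (c n))"
    proof (rule Hom_decomposesI)
      fix x assume x: "x \<in> carrier S"
      have "f x = (\<Oplus>\<^bsub>S\<^esub>n\<in>?N. c n x)"
        using Hom_decomposes_sum[OF c Hom_decomposesD(2)[OF c] _ x] by simp
      then show "?m f x = (\<Oplus>\<^bsub>S\<^esub>n\<in>?N. ?m (c n) x)"
        using x cn K_linear_finsum[OF K_linear_uminus Hom_decomposesD(2)[OF c], of "\<lambda>n. c n x"]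
        by simp
    qed (use Hom_decomposesD[OF c] in \<open>auto simp: Hom_deg_minus zero_map_def\<close>)
    then have "?m f \<in> carrier End" by (auto simp: End_simps)
    moreover have "?m f \<oplus>\<^bsub>End\<^esub> f = \<zero>\<^bsub>End\<^esub>"
      using End_carrierD(2)[OF f] by (auto simp: End_simps zero_map_def S.l_neg)
    ultimately show ?thesis by blast
  qed
  show "f \<oplus>\<^bsub>End\<^esub> g = g \<oplus>\<^bsub>End\<^esub> f" if "f \<in> carrier End" "g \<in> carrier End" for f g
    using that[THEN End_carrierD(2)] by (auto simp: End_simps(5) S.a_comm intro!: restrict_ext)
  show "(f \<oplus>\<^bsub>End\<^esub> g) \<oplus>\<^bsub>End\<^esub> h = f \<oplus>\<^bsub>End\<^esub> (g \<oplus>\<^bsub>End\<^esub> h)"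
    if "f \<in> carrier End" "g \<in> carrier End" "h \<in> carrier End" for f g h
    using that[THEN End_carrierD(2)] by (auto simp: End_simps(5) S.a_assoc intro!: restrict_ext)
  show "\<zero>\<^bsub>End\<^esub> \<oplus>\<^bsub>End\<^esub> f = f" if "f \<in> carrier End" for f
    by (rule End_eqI) (use End_carrierD[OF that] in \<open>auto simp: End_simps\<close>)
qed

interpretation E: abelian_group End by (rule End_abelian_group)

text \<open>Negation in \<open>End\<close> is an abstract group inverse; its pointwise form is what
  allows \<open>signed End\<close> to be evaluated at a point.\<close>

lemma End_minus:
  assumes "f \<in> H n"
  shows "\<ominus>\<^bsub>End\<^esub> f = (\<lambda>x\<in>carrier S. \<ominus>\<^bsub>S\<^esub> f x)"
  by (rule E.minus_equality)
    (use assms Hom_degD(5)[OF assms] Hom_deg_carrier[OF Hom_deg_minus[OF assms]] Hom_deg_carrier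
     in \<open>auto simp: End_simps(4,5) zero_map_def S.l_neg\<close>)

lemma End_signed_apply:
  "\<lbrakk>f \<in> H n; x \<in> carrier S\<rbrakk> \<Longrightarrow> signed End m f x = signed S m (f x)"
  by (simp add: signed_def End_minus)

lemma End_finsum_apply:
  assumes "finite N" "\<And>n. c n \<in> carrier End" "x \<in> carrier S"
  shows "(\<Oplus>\<^bsub>End\<^esub>n\<in>N. c n) x = (\<Oplus>\<^bsub>S\<^esub>n\<in>N. c n x)"
  using assms(1)
proof induction
  case empty
  then show ?case using assms(3) by (simp add: End_simps)
next
  case (insert n N)
  then show ?case
    using assms(2,3) End_carrierD(2)[OF assms(2,3)] by (simp add: End_simps(5))
qed

text \<open>One notion sums in the additive group of \<open>End\<close>, the other pointwise in
  \<open>S\<close>. They agree because finite sums of maps are evaluated pointwise.\<close>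

lemma decomposes_End_iff: "decomposes End f c \<longleftrightarrow> Hom_decomposes K A S f c"
proof -
  let ?N = "{n. c n \<noteq> zero_map S}"
  have "(\<Oplus>\<^bsub>End\<^esub>n\<in>N. c n) = (\<lambda>x\<in>carrier S. \<Oplus>\<^bsub>S\<^esub>n\<in>N. c n x)"
    if c: "\<And>n. c n \<in> H n" and N: "finite N" for N
  proof (rule End_eqI)
    have "(\<Oplus>\<^bsub>End\<^esub>n\<in>N. c n) \<in> carrier End"
      using Hom_deg_carrier[OF c] by (auto intro!: E.finsum_closed)
    then show "(\<Oplus>\<^bsub>End\<^esub>n\<in>N. c n) \<in> extensional (carrier S)" by (rule End_carrierD)
  qed (use End_finsum_apply[OF N Hom_deg_carrier[OF c]] in auto)
  then have "(\<Oplus>\<^bsub>End\<^esub>n\<in>?N. c n) = (\<lambda>x\<in>carrier S. \<Oplus>\<^bsub>S\<^esub>n\<in>?N. c n x)"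
    if "\<forall>n. c n \<in> H n" "finite ?N"
    using that by blast
  then show ?thesis
    unfolding decomposes_def Hom_decomposes_def End_simps(4,7) by (intro conj_cong) simp_all
qed

text \<open>On an argument of degree i the component of degree n lands in degree n + i, so the
  values of the components already are the components of the value.\<close>

lemma decomposes_apply:
  assumes f: "Hom_decomposes K A S f c" and x: "x \<in> grade S i"
  shows "decomposes S (f x) (\<lambda>j. c (j - i) x)"
proof (rule S.decomposesI)
  let ?N = "{n. c n \<noteq> zero_map S}"
  have xS: "x \<in> carrier S" using x by (rule S.grade_closed)
  show "c (j - i) x \<in> grade S j" for j
    using Hom_degD(3)[OF Hom_decomposesD(1)[OF f] x, of "j - i"] by simp
  show "finite ((\<lambda>n. n + i) ` ?N)" using Hom_decomposesD(2)[OF f] by simp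
  show "c (j - i) x = \<zero>\<^bsub>S\<^esub>" if "j \<notin> (\<lambda>n. n + i) ` ?N" for j
  proof -
    have "c (j - i) = zero_map S" using that by (auto simp: image_iff dest: spec[of _ "j - i"])
    then show ?thesis using xS by simp
  qed
  have "f x = (\<Oplus>\<^bsub>S\<^esub>n\<in>?N. c n x)"
    using Hom_decomposes_sum[OF f Hom_decomposesD(2)[OF f] _ xS] by simp
  also have "\<dots> = (\<Oplus>\<^bsub>S\<^esub>j\<in>(\<lambda>n. n + i) ` ?N. c (j - i) x)"
    using Hom_degD(5)[OF Hom_decomposesD(1)[OF f] xS]
    by (subst S.add.finprod_reindex) (auto simp: inj_on_def)
  finally show "f x = (\<Oplus>\<^bsub>S\<^esub>j\<in>(\<lambda>n. n + i) ` ?N. c (j - i) x)" .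
qed

text \<open>Uniqueness in \<open>S\<close> fixes each component on homogeneous arguments, and
  additivity fixes it everywhere.\<close>

lemma Hom_decomposes_unique:
  assumes c: "Hom_decomposes K A S f c" and c': "Hom_decomposes K A S f c'"
  shows "c = c'"
proof
  fix n
  note cn = Hom_degD[OF Hom_decomposesD(1)[OF c, of n]]
    and cn' = Hom_degD[OF Hom_decomposesD(1)[OF c', of n]]
  show "c n = c' n"
  proof (rule End_eqI)
    show "c n x = c' n x" if "x \<in> carrier S" for x
      using that
    proof (induction rule: S.graded_induct)
      case zero
      then show ?case using cn(2) cn'(2) by (simp add: K_linear_zero)
    next
      case (homogeneous i x)
      \<comment> \<open>In degree n + i of the common value stand \<open>c n x\<close> and
        \<open>c' n x\<close>.\<close>
      from fun_cong[OF S.decomposes_unique[OF decomposes_apply[OF c homogeneous]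
            decomposes_apply[OF c' homogeneous]], of "n + i"]
      show ?case by simp
    next
      case (add x y)
      then show ?case using cn(2) cn'(2) by (simp add: K_linearD)
    qed
  qed (use cn cn' in auto)
qed

lemma End_graded_group: "graded_group End"
proof -
  have "additive_subgroup (H n) End" for n
  proof (intro additive_subgroup.intro group.subgroupI)
    show "group (add_monoid End)" by (rule E.a_group)
    show "H n \<noteq> {}" using Hom_deg_zero by blast
    show "inv\<^bsub>add_monoid End\<^esub> f \<in> H n" if "f \<in> H n" for f
      using that Hom_deg_minus End_minus by (simp add: a_inv_def)
  qed (auto simp: Hom_deg_carrier End_simps(5) Hom_deg_add)
  moreover have "\<exists>!c. decomposes End f c" if "f \<in> carrier End" for f
    using that Hom_decomposes_unique by (auto simp: decomposes_End_iff End_simps(1))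
  ultimately show ?thesis
    by (intro graded_group.intro graded_group_axioms.intro End_abelian_group)
      (simp_all only: End_simps(7))
qed

interpretation E: graded_group End by (rule End_graded_group)

section \<open>Ring and scalar structure on the endomorphisms\<close>

lemma End_K_linear: "f \<in> carrier End \<Longrightarrow> K_linear K A S f"
proof (induction rule: E.graded_induct)
  case zero
  show ?case using Hom_degD(2)[OF Hom_deg_zero] by (simp add: End_simps(4))
next
  case (homogeneous n f)
  then show ?case by (simp add: End_simps Hom_degD(2))
next
  case (add f g)
  then show ?case unfolding End_simps(5) K_linear_restrict by (intro K_linear_add)
qed

lemma End_apply:
  assumes "x \<in> carrier S"
  shows "(f \<otimes>\<^bsub>End\<^esub> g) x = f (g x)" "\<one>\<^bsub>End\<^esub> x = x" "\<zero>\<^bsub>End\<^esub> x = \<zero>\<^bsub>S\<^esub>"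
    "(f \<oplus>\<^bsub>End\<^esub> g) x = f x \<oplus>\<^bsub>S\<^esub> g x" "(k \<odot>\<^bsub>End\<^esub> f) x = scal A S k (f x)"
  using assms by (simp_all add: End_simps compose_def)

lemma End_extensional [simp]:
  "f \<otimes>\<^bsub>End\<^esub> g \<in> extensional (carrier S)" "\<one>\<^bsub>End\<^esub> \<in> extensional (carrier S)"
  "\<zero>\<^bsub>End\<^esub> \<in> extensional (carrier S)" "f \<oplus>\<^bsub>End\<^esub> g \<in> extensional (carrier S)"
  "k \<odot>\<^bsub>End\<^esub> f \<in> extensional (carrier S)"
  by (simp_all add: End_simps compose_def zero_map_def)

lemma End_mult_l_distr:
  assumes "f \<in> carrier End" "g \<in> carrier End" "h \<in> carrier End"
  shows "(f \<oplus>\<^bsub>End\<^esub> g) \<otimes>\<^bsub>End\<^esub> h = f \<otimes>\<^bsub>End\<^esub> h \<oplus>\<^bsub>End\<^esub> g \<otimes>\<^bsub>End\<^esub> h"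
  by (rule End_eqI) (use assms[THEN End_carrierD(2)] in \<open>simp_all add: End_apply\<close>)

lemma End_mult_r_distr:
  assumes "f \<in> carrier End" "g \<in> carrier End" "h \<in> carrier End"
  shows "h \<otimes>\<^bsub>End\<^esub> (f \<oplus>\<^bsub>End\<^esub> g) = h \<otimes>\<^bsub>End\<^esub> f \<oplus>\<^bsub>End\<^esub> h \<otimes>\<^bsub>End\<^esub> g"
  by (rule End_eqI)
    (use assms[THEN End_carrierD(2)] K_linearD(2)[OF End_K_linear[OF assms(3)]]
      in \<open>simp_all add: End_apply\<close>)

text \<open>Instead of writing down the convolution of two decompositions, a graded induction in
  each factor reduces the claim to \<open>Hom_deg_comp\<close>.\<close>

lemma End_mult_closed:
  assumes f: "f \<in> carrier End" and g: "g \<in> carrier End"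
  shows "f \<otimes>\<^bsub>End\<^esub> g \<in> carrier End"
  using f
proof (induction rule: E.graded_induct)
  case zero
  have "\<zero>\<^bsub>End\<^esub> \<otimes>\<^bsub>End\<^esub> g = \<zero>\<^bsub>End\<^esub>"
    by (rule End_eqI) (use End_carrierD(2)[OF g] in \<open>simp_all add: End_apply\<close>)
  then show ?case by simp
next
  case (homogeneous m f)
  then have f: "f \<in> H m" "f \<in> carrier End" by (simp_all add: End_simps(7) Hom_deg_carrier)
  show ?case
    using g
  proof (induction rule: E.graded_induct)
    case zero
    have "f \<otimes>\<^bsub>End\<^esub> \<zero>\<^bsub>End\<^esub> = \<zero>\<^bsub>End\<^esub>"
      by (rule End_eqI) (use K_linear_zero[OF End_K_linear[OF f(2)]] in \<open>simp_all add: End_apply\<close>)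
    then show ?case by simp
  next
    case (homogeneous n g)
    then show ?case
      using Hom_deg_carrier[OF Hom_deg_comp[OF f(1)]] by (simp add: End_simps(2,7))
  next
    case (add g h)
    then show ?case using f(2) by (simp add: End_mult_r_distr)
  qed
next
  case (add f h)
  then show ?case using g by (simp add: End_mult_l_distr)
qed

lemma End_ring: "ring End"
proof (rule ringI)
  show "monoid End"
  proof (rule monoidI)
    show "\<one>\<^bsub>End\<^esub> \<in> carrier End"
      using Hom_deg_carrier[OF Hom_deg_id] by (simp add: End_simps(3))
    show "f \<otimes>\<^bsub>End\<^esub> g \<otimes>\<^bsub>End\<^esub> h = f \<otimes>\<^bsub>End\<^esub> (g \<otimes>\<^bsub>End\<^esub> h)"
      if "f \<in> carrier End" "g \<in> carrier End" "h \<in> carrier End" for f g h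
      by (rule End_eqI) (use that[THEN End_carrierD(2)] in \<open>simp_all add: End_apply\<close>)
    show "\<one>\<^bsub>End\<^esub> \<otimes>\<^bsub>End\<^esub> f = f" "f \<otimes>\<^bsub>End\<^esub> \<one>\<^bsub>End\<^esub> = f" if "f \<in> carrier End" for f
      by (rule End_eqI; use that[THEN End_carrierD(1)] that[THEN End_carrierD(2)]
          in \<open>simp add: End_apply\<close>)+
  qed (rule End_mult_closed)
qed (auto intro: End_abelian_group End_mult_l_distr End_mult_r_distr)

lemma scal_add_left:
  "\<lbrakk>k \<in> carrier K; l \<in> carrier K; x \<in> carrier S\<rbrakk> \<Longrightarrow>
    scal A S (k \<oplus>\<^bsub>K\<^esub> l) x = scal A S k x \<oplus>\<^bsub>S\<^esub> scal A S l x"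
  by (simp add: scal_def A.smult_l_distr act_l_distr A.smult_closed)

text \<open>The map from k to k * 1 is multiplicative.\<close>

lemma scal_assoc:
  assumes "k \<in> carrier K" "l \<in> carrier K" "x \<in> carrier S"
  shows "scal A S (k \<otimes>\<^bsub>K\<^esub> l) x = scal A S k (scal A S l x)"
proof -
  have "(k \<otimes>\<^bsub>K\<^esub> l) \<odot>\<^bsub>A\<^esub> \<one>\<^bsub>A\<^esub> = (k \<odot>\<^bsub>A\<^esub> \<one>\<^bsub>A\<^esub>) \<otimes>\<^bsub>A\<^esub> (l \<odot>\<^bsub>A\<^esub> \<one>\<^bsub>A\<^esub>)"
    using assms by (simp add: A.smult_assoc1 A.smult_mult_left A.smult_closed)
  then show ?thesis using assms by (simp add: scal_def act_assoc A.smult_closed)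
qed

lemma scal_one: "x \<in> carrier S \<Longrightarrow> scal A S \<one>\<^bsub>K\<^esub> x = x"
  by (simp add: scal_def act_one A.smult_one)

lemma End_smult_r_distr:
  assumes "k \<in> carrier K" "f \<in> carrier End" "g \<in> carrier End"
  shows "k \<odot>\<^bsub>End\<^esub> (f \<oplus>\<^bsub>End\<^esub> g) = k \<odot>\<^bsub>End\<^esub> f \<oplus>\<^bsub>End\<^esub> k \<odot>\<^bsub>End\<^esub> g"
  by (rule End_eqI)
    (use assms(2,3)[THEN End_carrierD(2)] K_linearD(2)[OF K_linear_scal[OF assms(1)]]
      in \<open>simp_all add: End_apply\<close>)

lemma End_smult_zero: "k \<in> carrier K \<Longrightarrow> k \<odot>\<^bsub>End\<^esub> \<zero>\<^bsub>End\<^esub> = \<zero>\<^bsub>End\<^esub>"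
  by (rule End_eqI) (simp_all add: End_apply K_linear_zero[OF K_linear_scal])

lemma End_module: "module K End"
proof (rule moduleI)
  show "cring K" using A.module_axioms by (rule module.axioms)
  show "k \<odot>\<^bsub>End\<^esub> f \<in> carrier End" if k: "k \<in> carrier K" and f: "f \<in> carrier End" for k f
    using f
  proof (induction rule: E.graded_induct)
    case (homogeneous n f)
    then show ?case
      using Hom_deg_carrier[OF Hom_deg_scal[OF _ k]] unfolding End_simps(6,7) by blast
  qed (use k in \<open>simp_all add: End_smult_zero End_smult_r_distr\<close>)
  show "(k \<oplus>\<^bsub>K\<^esub> l) \<odot>\<^bsub>End\<^esub> f = k \<odot>\<^bsub>End\<^esub> f \<oplus>\<^bsub>End\<^esub> l \<odot>\<^bsub>End\<^esub> f"
    if "k \<in> carrier K" "l \<in> carrier K" "f \<in> carrier End" for k l f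
    by (rule End_eqI) (use that End_carrierD(2)[OF that(3)] in \<open>simp_all add: End_apply scal_add_left\<close>)
  show "(k \<otimes>\<^bsub>K\<^esub> l) \<odot>\<^bsub>End\<^esub> f = k \<odot>\<^bsub>End\<^esub> (l \<odot>\<^bsub>End\<^esub> f)"
    if "k \<in> carrier K" "l \<in> carrier K" "f \<in> carrier End" for k l f
    by (rule End_eqI) (use that End_carrierD(2)[OF that(3)] in \<open>simp_all add: End_apply scal_assoc\<close>)
  show "\<one>\<^bsub>K\<^esub> \<odot>\<^bsub>End\<^esub> f = f" if "f \<in> carrier End" for f
    by (rule End_eqI) (use End_carrierD[OF that] in \<open>simp_all add: End_apply scal_one\<close>)
qed (rule End_abelian_group, rule End_smult_r_distr)

section \<open>The differential on the endomorphisms\<close>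

lemma bracket_apply:
  "x \<in> carrier S \<Longrightarrow>
    bracket n f x = differential S (f x) \<ominus>\<^bsub>S\<^esub> signed S n (f (differential S x))"
  by (simp add: bracket_def)

lemma bracket_zero: "bracket n (zero_map S) = zero_map S"
  using K_linear_zero[OF delta_linear] delta_closed
  by (auto simp: bracket_def zero_map_def S.minus_eq intro!: restrict_ext)

lemma bracket_add:
  assumes f: "f \<in> H n" and g: "g \<in> H n" and x: "x \<in> carrier S"
  shows "bracket n (f \<oplus>\<^bsub>End\<^esub> g) x = bracket n f x \<oplus>\<^bsub>S\<^esub> bracket n g x"
  using x Hom_degD(5)[OF f] Hom_degD(5)[OF g] K_linearD(2)[OF delta_linear]
  by (simp add: bracket_apply End_apply delta_closed S.minus_eq S.signed_add S.minus_add S.a_ac)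

text \<open>Uniqueness lets any exhibited decomposition replace the definite description.\<close>

lemma Hom_component_eq: "Hom_decomposes K A S f c \<Longrightarrow> Hom_component K A S f = c"
  unfolding Hom_component_def by (blast intro: the_equality Hom_decomposes_unique)

lemma d_Hom_extensional [simp]: "d_Hom K A S f \<in> extensional (carrier S)"
  by (simp add: d_Hom_def Let_def)

text \<open>Surplus indices contribute nothing by \<open>bracket_zero\<close>, so
  \<open>d_Hom\<close> of two maps and of their sum can be computed over the union of the
  supports.\<close>

lemma d_Hom_apply:
  assumes f: "Hom_decomposes K A S f c" and N: "finite N" "\<And>n. n \<notin> N \<Longrightarrow> c n = zero_map S"
    and x: "x \<in> carrier S"
  shows "d_Hom K A S f x = (\<Oplus>\<^bsub>S\<^esub>n\<in>N. bracket n (c n) x)"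
proof -
  have sub: "{n. c n \<noteq> zero_map S} \<subseteq> N" using N(2) by blast
  have "(\<Oplus>\<^bsub>S\<^esub>n\<in>N. bracket n (c n) x) = (\<Oplus>\<^bsub>S\<^esub>n\<in>{n. c n \<noteq> zero_map S}. bracket n (c n) x)"
    by (rule S.add.finprod_mono_neutral_cong_right)
      (use N(1) sub x Hom_degD(5)[OF Hom_deg_bracket[OF Hom_decomposesD(1)[OF f]]]
        in \<open>auto simp: bracket_zero\<close>)
  then show ?thesis
    using x by (simp add: d_Hom_def Hom_component_eq[OF f] bracket_apply)
qed

lemma d_Hom_homogeneous:
  assumes "f \<in> H n"
  shows "d_Hom K A S f = bracket n f"
proof (rule End_eqI)
  let ?c = "\<lambda>i. if i = n then f else zero_map S"
  have "Hom_decomposes K A S f ?c"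
    using E.decomposes_homogeneous[of f n] assms unfolding decomposes_End_iff End_simps(4,7) .
  from d_Hom_apply[OF this, of "{n}"]
  show "d_Hom K A S f x = bracket n f x" if "x \<in> carrier S" for x
    using that Hom_degD(5)[OF Hom_deg_bracket[OF assms]] by simp
  show "bracket n f \<in> extensional (carrier S)"
    using Hom_degD(1)[OF Hom_deg_bracket[OF assms]] .
qed simp

lemma d_Hom_add:
  assumes "f \<in> carrier End" "g \<in> carrier End"
  shows "d_Hom K A S (f \<oplus>\<^bsub>End\<^esub> g) = d_Hom K A S f \<oplus>\<^bsub>End\<^esub> d_Hom K A S g"
proof (rule End_eqI)
  fix x assume x: "x \<in> carrier S"
  obtain c c' where f: "Hom_decomposes K A S f c" and g: "Hom_decomposes K A S g c'"
    using assms by (auto simp: End_simps(1))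
  let ?N = "{n. c n \<noteq> zero_map S} \<union> {n. c' n \<noteq> zero_map S}"
  note cH = Hom_decomposesD(1)[OF f] and cH' = Hom_decomposesD(1)[OF g]
  have fin: "finite ?N" using Hom_decomposesD(2) f g by auto
  have "c n \<oplus>\<^bsub>End\<^esub> c' n = zero_map S" if "n \<notin> ?N" for n
    using that by (auto simp: End_simps zero_map_def)
  from d_Hom_apply[OF Hom_decomposes_add[OF f g] fin this x]
  have "d_Hom K A S (f \<oplus>\<^bsub>End\<^esub> g) x =
      (\<Oplus>\<^bsub>S\<^esub>n\<in>?N. bracket n (c n) x \<oplus>\<^bsub>S\<^esub> bracket n (c' n) x)"
    by (simp add: bracket_add[OF cH cH' x])
  also have "\<dots> = d_Hom K A S f x \<oplus>\<^bsub>S\<^esub> d_Hom K A S g x"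
    using d_Hom_apply[OF f fin _ x] d_Hom_apply[OF g fin _ x]
      Hom_degD(5)[OF Hom_deg_bracket[OF cH] x] Hom_degD(5)[OF Hom_deg_bracket[OF cH'] x]
    by (simp add: S.finsum_addf)
  finally show "d_Hom K A S (f \<oplus>\<^bsub>End\<^esub> g) x = (d_Hom K A S f \<oplus>\<^bsub>End\<^esub> d_Hom K A S g) x"
    using x by (simp add: End_apply)
qed simp_all

lemma d_Hom_zero: "d_Hom K A S \<zero>\<^bsub>End\<^esub> = \<zero>\<^bsub>End\<^esub>"
  using d_Hom_homogeneous[OF Hom_deg_zero] by (simp add: End_simps(4) bracket_zero)

lemma d_Hom_closed: "f \<in> carrier End \<Longrightarrow> d_Hom K A S f \<in> carrier End"
proof (induction rule: E.graded_induct)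
  case (homogeneous n f)
  then show ?case
    using Hom_deg_carrier[OF Hom_deg_bracket] d_Hom_homogeneous by (simp add: End_simps(7))
qed (simp_all add: d_Hom_zero d_Hom_add)

lemma d_Hom_smult:
  assumes k: "k \<in> carrier K" and f: "f \<in> carrier End"
  shows "d_Hom K A S (k \<odot>\<^bsub>End\<^esub> f) = k \<odot>\<^bsub>End\<^esub> d_Hom K A S f"
  using f
proof (induction rule: E.graded_induct)
  case zero
  then show ?case using k by (simp add: d_Hom_zero End_smult_zero)
next
  case (homogeneous n f)
  then have f: "f \<in> H n" by (simp add: End_simps(7))
  have kf: "k \<odot>\<^bsub>End\<^esub> f \<in> H n" using Hom_deg_scal[OF f k] by (simp add: End_simps(6))
  have "bracket n (k \<odot>\<^bsub>End\<^esub> f) = k \<odot>\<^bsub>End\<^esub> bracket n f"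
  proof (rule End_eqI)
    show "bracket n (k \<odot>\<^bsub>End\<^esub> f) x = (k \<odot>\<^bsub>End\<^esub> bracket n f) x" if x: "x \<in> carrier S" for x
      using k x Hom_degD(5)[OF f] delta_closed
      by (simp add: bracket_apply End_apply S.minus_eq K_linearD(3)[OF delta_linear]
          K_linearD(2)[OF K_linear_scal] K_linear_minus[OF K_linear_scal]
          K_linear_signed[OF K_linear_scal])
  qed (simp_all add: bracket_def)
  then show ?case by (simp add: d_Hom_homogeneous[OF f] d_Hom_homogeneous[OF kf])
next
  case (add f g)
  then show ?case
    using k module.smult_closed[OF End_module]
    by (simp add: End_smult_r_distr d_Hom_add d_Hom_closed)
qed

text \<open>The outer terms die because the differential of \<open>S\<close> squares to zero. The
  two mixed terms, with \<open>f\<close> between two differentials, have opposite signs since the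
  second commutator is taken in degree n + 1.\<close>

lemma d_Hom_d_Hom: "f \<in> carrier End \<Longrightarrow> d_Hom K A S (d_Hom K A S f) = \<zero>\<^bsub>End\<^esub>"
proof (induction rule: E.graded_induct)
  case (homogeneous n f)
  then have f: "f \<in> H n" by (simp add: End_simps(7))
  have "bracket (n + 1) (bracket n f) = \<zero>\<^bsub>End\<^esub>"
  proof (rule End_eqI)
    fix x assume x: "x \<in> carrier S"
    have zero: "f \<zero>\<^bsub>S\<^esub> = \<zero>\<^bsub>S\<^esub>" using f by (simp add: K_linear_zero Hom_degD(2))
    show "bracket (n + 1) (bracket n f) x = \<zero>\<^bsub>End\<^esub> x"
      using x Hom_degD(5)[OF f] delta_closed zero
      by (cases "even n")
        (simp_all add: bracket_apply End_apply S.minus_eq K_linearD(2)[OF delta_linear]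
          K_linear_minus[OF delta_linear] delta_delta signed_def S.l_neg S.r_neg S.minus_zero_eq)
  qed (simp_all add: bracket_def)
  then show ?case
    by (simp add: d_Hom_homogeneous[OF f] d_Hom_homogeneous[OF Hom_deg_bracket[OF f]])
qed (simp_all add: d_Hom_zero d_Hom_add d_Hom_closed)

text \<open>Expanding the right side yields the term f, differential, g twice with opposite signs;
  what is left is the commutator with the composite.\<close>

lemma bracket_mult:
  assumes f: "f \<in> H m" and g: "g \<in> H n"
  shows "bracket (m + n) (f \<otimes>\<^bsub>End\<^esub> g) =
    bracket m f \<otimes>\<^bsub>End\<^esub> g \<oplus>\<^bsub>End\<^esub> signed End m (f \<otimes>\<^bsub>End\<^esub> bracket n g)"
proof (rule End_eqI)
  fix x assume x: "x \<in> carrier S"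
  \<comment> \<open>A degree is recorded because \<open>End_signed_apply\<close> evaluates signs
    pointwise for homogeneous maps.\<close>
  have fg: "f \<otimes>\<^bsub>End\<^esub> bracket n g \<in> H (m + (n + 1))"
    using Hom_deg_comp[OF f Hom_deg_bracket[OF g]] by (simp add: End_simps(2))
  then have "signed End m (f \<otimes>\<^bsub>End\<^esub> bracket n g) x = signed S m (f (bracket n g x))"
    using x by (simp add: End_signed_apply End_apply)
  then show "bracket (m + n) (f \<otimes>\<^bsub>End\<^esub> g) x =
      (bracket m f \<otimes>\<^bsub>End\<^esub> g \<oplus>\<^bsub>End\<^esub> signed End m (f \<otimes>\<^bsub>End\<^esub> bracket n g)) x"
    using x Hom_degD(5)[OF f] Hom_degD(5)[OF g] delta_closed
    by (simp only: End_apply, cases "even m"; cases "even n")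
      (simp_all add: bracket_apply End_apply S.minus_eq
        K_linearD(2)[OF Hom_degD(2)[OF f]] K_linear_minus[OF Hom_degD(2)[OF f]] signed_def
        S.minus_add S.a_ac S.add_minus_cancel S.r_neg1 S.r_neg2)
qed (simp_all add: bracket_def)

lemma dg_End_dg_algebra: "dg_algebra K End"
proof (intro dg_algebra.intro dg_algebra_axioms.intro)
  show "field K" using A.dg_algebra_axioms by (rule dg_algebra.axioms)
  show "k \<odot>\<^bsub>End\<^esub> f \<otimes>\<^bsub>End\<^esub> g = k \<odot>\<^bsub>End\<^esub> (f \<otimes>\<^bsub>End\<^esub> g)"
    if "k \<in> carrier K" "f \<in> carrier End" "g \<in> carrier End" for k f g
    by (rule End_eqI) (use that End_carrierD(2)[OF that(3)] in \<open>simp_all add: End_apply\<close>)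
  show "f \<otimes>\<^bsub>End\<^esub> (k \<odot>\<^bsub>End\<^esub> g) = k \<odot>\<^bsub>End\<^esub> (f \<otimes>\<^bsub>End\<^esub> g)"
    if "k \<in> carrier K" "f \<in> carrier End" "g \<in> carrier End" for k f g
    by (rule End_eqI)
      (use that End_carrierD(2)[OF that(3)] K_linearD(3)[OF End_K_linear[OF that(2)]]
        in \<open>simp_all add: End_apply\<close>)
  show "k \<odot>\<^bsub>End\<^esub> f \<in> grade End n" if "k \<in> carrier K" "f \<in> grade End n" for k f n
    using Hom_deg_scal that by (simp add: End_simps(6,7))
  show "f \<otimes>\<^bsub>End\<^esub> g \<in> grade End (m + n)" if "f \<in> grade End m" "g \<in> grade End n" for f g m n
    using Hom_deg_comp that by (simp add: End_simps(2,7))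
  show "differential End f \<in> grade End (n + 1)" if "f \<in> grade End n" for f n
    using Hom_deg_bracket that by (simp add: End_simps(7,8) d_Hom_homogeneous)
  show "differential End (f \<otimes>\<^bsub>End\<^esub> g) = differential End f \<otimes>\<^bsub>End\<^esub> g \<oplus>\<^bsub>End\<^esub>
      signed End m (f \<otimes>\<^bsub>End\<^esub> differential End g)"
    if "f \<in> grade End m" "g \<in> grade End n" for f g m n
  proof -
    have fg: "f \<in> H m" "g \<in> H n" using that by (simp_all add: End_simps(7))
    then have "f \<otimes>\<^bsub>End\<^esub> g \<in> H (m + n)" using Hom_deg_comp by (simp add: End_simps(2))
    with fg show ?thesis by (simp add: End_simps(8) d_Hom_homogeneous bracket_mult)
  qed
qed (simp_all add: End_module End_ring End_graded_group End_simps(8) d_Hom_add d_Hom_smult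
    d_Hom_d_Hom)

subsection \<open>Schur's lemma for cycles\<close>

text \<open>Vanishing of the bracket is commutation with the differential up to sign, which makes
  kernel and image stable under it.\<close>

lemma cycle_commutes:
  assumes u: "u \<in> H n" "differential End u = \<zero>\<^bsub>End\<^esub>" and x: "x \<in> carrier S"
  shows "differential S (u x) = signed S n (u (differential S x))"
proof -
  have "bracket n u x = \<zero>\<^bsub>S\<^esub>"
    using u x by (simp add: End_simps(8) d_Hom_homogeneous End_apply)
  then show ?thesis
    using x by (intro S.minus_eq_zeroD[of "differential S (u x)" "signed S n (u (differential S x))"])
      (simp_all add: bracket_apply Hom_degD(5)[OF u(1)] delta_closed)
qed

text \<open>A map of degree n carries components to components with the index shifted by n. This
  yields gradedness of kernel and image as well as the degree of the inverse.\<close>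

lemma Hom_deg_decomposes:
  assumes u: "u \<in> H n" and c: "decomposes S x c"
  shows "decomposes S (u x) (\<lambda>j. u (c (j - n)))"
proof (rule S.decomposesI)
  let ?I = "{i. c i \<noteq> \<zero>\<^bsub>S\<^esub>}"
  note lin = Hom_degD(2)[OF u] and cS = S.decomposes_closed[OF c]
  show "u (c (j - n)) \<in> grade S j" for j
    using Hom_degD(3)[OF u S.decomposesD(1)[OF c], of "j - n"] by simp
  show "finite ((\<lambda>i. i + n) ` ?I)" using S.decomposesD(2)[OF c] by simp
  show "u (c (j - n)) = \<zero>\<^bsub>S\<^esub>" if "j \<notin> (\<lambda>i. i + n) ` ?I" for j
  proof -
    have "c (j - n) = \<zero>\<^bsub>S\<^esub>" using that by (auto simp: image_iff dest: spec[of _ "j - n"])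
    then show ?thesis using K_linear_zero[OF lin] by simp
  qed
  have "u x = (\<Oplus>\<^bsub>S\<^esub>i\<in>?I. u (c i))"
    by (subst S.decomposesD(3)[OF c], rule K_linear_finsum[OF lin S.decomposesD(2)[OF c]], rule cS)
  also have "\<dots> = (\<Oplus>\<^bsub>S\<^esub>j\<in>(\<lambda>i. i + n) ` ?I. u (c (j - n)))"
    using K_linearD(1)[OF lin cS] by (subst S.add.finprod_reindex) (auto simp: inj_on_def)
  finally show "u x = (\<Oplus>\<^bsub>S\<^esub>j\<in>(\<lambda>i. i + n) ` ?I. u (c (j - n)))" .
qed

lemma act_zero_left: "x \<in> carrier S \<Longrightarrow> \<zero>\<^bsub>A\<^esub> \<odot>\<^bsub>S\<^esub> x = \<zero>\<^bsub>S\<^esub>"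
  using act_l_distr[of "\<zero>\<^bsub>A\<^esub>" "\<zero>\<^bsub>A\<^esub>" x] act_closed[of "\<zero>\<^bsub>A\<^esub>" x]
  by (simp add: A.grade_closed[OF A.grade_zero])

lemma additive_subgroupI:
  assumes "N \<subseteq> carrier S" "\<zero>\<^bsub>S\<^esub> \<in> N" "\<And>x. x \<in> N \<Longrightarrow> \<ominus>\<^bsub>S\<^esub> x \<in> N"
    "\<And>x y. \<lbrakk>x \<in> N; y \<in> N\<rbrakk> \<Longrightarrow> x \<oplus>\<^bsub>S\<^esub> y \<in> N"
  shows "additive_subgroup N S"
  by (intro additive_subgroup.intro group.subgroupI S.a_group)
    (use assms in \<open>auto simp flip: a_inv_def\<close>)

lemma dg_submodule_kernel:
  assumes u: "u \<in> H n" "differential End u = \<zero>\<^bsub>End\<^esub>"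
  shows "dg_submodule A S {x \<in> carrier S. u x = \<zero>\<^bsub>S\<^esub>}" (is "dg_submodule A S ?N")
proof -
  note lin = Hom_degD(2)[OF u(1)]
  have sub: "additive_subgroup ?N S"
    by (rule additive_subgroupI)
      (auto simp: K_linearD[OF lin] K_linear_zero[OF lin] K_linear_minus[OF lin])
  have grd: "\<exists>c. (\<forall>i. c i \<in> ?N) \<and> decomposes S x c" if x: "x \<in> ?N" for x
  proof -
    obtain c where c: "decomposes S x c" using S.direct_sum x by blast
    \<comment> \<open>For \<open>x\<close> in the kernel the images of its components decompose 0,
      so uniqueness makes each of them vanish.\<close>
    have "decomposes S \<zero>\<^bsub>S\<^esub> (\<lambda>j. u (c (j - n)))"
      using Hom_deg_decomposes[OF u(1) c] x by simp
    moreover have "decomposes S \<zero>\<^bsub>S\<^esub> (\<lambda>j. \<zero>\<^bsub>S\<^esub>)"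
      by (rule S.decomposesI[where N = "{}"]) (auto simp: S.grade_zero)
    ultimately have "(\<lambda>j. u (c (j - n))) = (\<lambda>j. \<zero>\<^bsub>S\<^esub>)"
      by (rule S.decomposes_unique)
    from fun_cong[OF this, of "i + n" for i] have "u (c i) = \<zero>\<^bsub>S\<^esub>" for i by simp
    with c show ?thesis using S.decomposes_closed by blast
  qed
  have act: "a \<odot>\<^bsub>S\<^esub> x \<in> ?N" if "a \<in> carrier A" and x: "x \<in> ?N" for a x
    using that(1)
  proof (induction rule: A.graded_induct)
    case (homogeneous i a)
    then show ?case
      using x A.grade_closed[OF homogeneous]
      by (simp add: Hom_degD(4)[OF u(1)] act_closed K_linear_zero[OF K_linear_act])
  qed (use x in \<open>simp_all add: act_zero_left act_l_distr K_linear_zero[OF lin] K_linearD[OF lin]\<close>)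
  have "u (differential S x) = \<zero>\<^bsub>S\<^esub>" if x: "x \<in> carrier S" "u x = \<zero>\<^bsub>S\<^esub>" for x
  proof -
    have "signed S n (u (differential S x)) = \<zero>\<^bsub>S\<^esub>"
      using cycle_commutes[OF u x(1)] x(2) K_linear_zero[OF delta_linear] by simp
    \<comment> \<open>A second application of the sign gives (-1)^(2n) = 1 and removes it.\<close>
    then show ?thesis
      using S.signed_signed[of "u (differential S x)" n n] x(1)
      by (simp add: delta_closed K_linearD[OF lin])
  qed
  then show ?thesis
    using sub grd act delta_closed unfolding dg_submodule_def graded_subgroup_def by blast
qed

lemma dg_submodule_image:
  assumes u: "u \<in> H n" "differential End u = \<zero>\<^bsub>End\<^esub>"
  shows "dg_submodule A S (u ` carrier S)"
proof -
  note lin = Hom_degD(2)[OF u(1)]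
  have mem: "y \<in> u ` carrier S" if "y = u x" "x \<in> carrier S" for x y using that by blast
  have sum: "y \<oplus>\<^bsub>S\<^esub> z \<in> u ` carrier S" if "y \<in> u ` carrier S" "z \<in> u ` carrier S" for y z
    using that by (auto simp flip: K_linearD(2)[OF lin])
  have sub: "additive_subgroup (u ` carrier S) S"
    by (rule additive_subgroupI[OF _ mem[of _ "\<zero>\<^bsub>S\<^esub>"] _ sum])
      (auto simp: K_linearD(1)[OF lin] K_linear_zero[OF lin] simp flip: K_linear_minus[OF lin])
  have grd: "\<exists>c'. (\<forall>i. c' i \<in> u ` carrier S) \<and> decomposes S (u x) c'" if x: "x \<in> carrier S" for x
  proof -
    obtain c where c: "decomposes S x c" using S.direct_sum x by blast
    show ?thesis
      by (intro exI[of _ "\<lambda>j. u (c (j - n))"] conjI allI imageI S.decomposes_closed[OF c]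
          Hom_deg_decomposes[OF u(1) c])
  qed
  have act: "a \<odot>\<^bsub>S\<^esub> u x \<in> u ` carrier S" if "a \<in> carrier A" and x: "x \<in> carrier S" for a x
    using that(1)
  proof (induction rule: A.graded_induct)
    case zero
    then show ?case
      using x by (intro mem[of _ "\<zero>\<^bsub>S\<^esub>"]) (simp_all add: act_zero_left K_linearD(1)[OF lin] K_linear_zero[OF lin])
  next
    case (homogeneous i a)
    then show ?case
      using x A.grade_closed[OF homogeneous]
      \<comment> \<open>The preimage carries the sign (-1)^(i*n), which cancels the one produced
        when \<open>u\<close> passes \<open>a\<close>.\<close>
      by (intro mem[of _ "signed S (i * n) (a \<odot>\<^bsub>S\<^esub> x)"])
        (simp_all add: Hom_degD(4)[OF u(1)] act_closed K_linear_signed[OF lin] S.signed_signed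
          K_linearD(1)[OF lin])
  next
    case (add a b)
    then show ?case using sum x
      by (simp add: act_l_distr K_linearD(1)[OF lin])
  qed
  have "differential S (u x) \<in> u ` carrier S" if x: "x \<in> carrier S" for x
    \<comment> \<open>By \<open>cycle_commutes\<close> the sign (-1)^n can be moved into the
      argument of \<open>u\<close>.\<close>
    using x by (intro mem[of _ "signed S n (differential S x)"])
      (simp_all add: cycle_commutes[OF u] K_linear_signed[OF lin] delta_closed)
  then show ?thesis
    using sub grd act unfolding dg_submodule_def graded_subgroup_def by blast
qed

text \<open>Every property of the inverse is checked after applying \<open>u\<close>, by
  injectivity. Only homogeneity needs more: it comes from comparing components of y with the images
  of the components of its preimage.\<close>

lemma Hom_deg_inverse:
  assumes u: "u \<in> H n" and bij: "bij_betw u (carrier S) (carrier S)"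
  shows "(\<lambda>y\<in>carrier S. the_inv_into (carrier S) u y) \<in> H (- n)"
proof -
  let ?v = "\<lambda>y\<in>carrier S. the_inv_into (carrier S) u y"
  note lin = Hom_degD(2)[OF u]
  have inj: "inj_on u (carrier S)" and img: "u ` carrier S = carrier S"
    using bij by (auto simp: bij_betw_def)
  \<comment> \<open>Turns each claim about a value of the inverse into an equation for
    \<open>u\<close>.\<close>
  have v: "?v y = x" if "x \<in> carrier S" "u x = y" for x y
    using that the_inv_into_f_f[OF inj] K_linearD(1)[OF lin] by auto
  have uv: "u (?v y) = y" and vS: "?v y \<in> carrier S" if "y \<in> carrier S" for y
    using that f_the_inv_into_f[OF inj] the_inv_into_into[OF inj] img by auto
  show ?thesis
  proof (rule Hom_degI)
    show "K_linear K A S ?v"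
      unfolding K_linear_def
      by (intro conjI ballI; (intro v)?)
        (use vS in \<open>auto simp: K_linearD[OF lin] uv scal_closed simp del: restrict_apply\<close>)
  next
    fix i y assume y: "y \<in> grade S i"
    then have yS: "y \<in> carrier S" by (rule S.grade_closed)
    obtain c where c: "decomposes S (?v y) c" using S.direct_sum vS[OF yS] by blast
    \<comment> \<open>Since \<open>y\<close> is concentrated in degree i, the component of its
      preimage in degree i - n is already mapped to \<open>y\<close>, hence is the whole
      preimage.\<close>
    have "decomposes S y (\<lambda>j. u (c (j - n)))"
      using Hom_deg_decomposes[OF u c] uv[OF yS] by simp
    from fun_cong[OF S.decomposes_unique[OF this S.decomposes_homogeneous[OF y]], of i]
    have "u (c (i - n)) = y" by simp
    then have "?v y = c (i - n)" using S.decomposes_closed[OF c] by (intro v)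
    then show "?v y \<in> grade S (i + - n)" using S.decomposesD(1)[OF c, of "i - n"] by simp
  next
    fix i a y assume a: "a \<in> grade A i" and y: "y \<in> carrier S"
    show "?v (a \<odot>\<^bsub>S\<^esub> y) = signed S (i * - n) (a \<odot>\<^bsub>S\<^esub> ?v y)"
    proof (rule v)
      have av: "a \<odot>\<^bsub>S\<^esub> ?v y \<in> carrier S"
        using A.grade_closed[OF a] vS[OF y] by (rule act_closed)
      then show "signed S (i * - n) (a \<odot>\<^bsub>S\<^esub> ?v y) \<in> carrier S" by (rule S.signed_closed)
      have "u (a \<odot>\<^bsub>S\<^esub> ?v y) = signed S (i * n) (a \<odot>\<^bsub>S\<^esub> y)"
        using Hom_degD(4)[OF u a vS[OF y]] unfolding uv[OF y] .
      then show "u (signed S (i * - n) (a \<odot>\<^bsub>S\<^esub> ?v y)) = a \<odot>\<^bsub>S\<^esub> y"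
        using K_linear_signed[OF lin av] act_closed[OF A.grade_closed[OF a] y]
        by (simp add: S.signed_signed del: restrict_apply)
    qed
  qed simp
qed

lemma nonzero_cycle_Units:
  assumes simple: "dg_simple K A S"
    and u: "u \<in> H n" "u \<noteq> \<zero>\<^bsub>End\<^esub>" "differential End u = \<zero>\<^bsub>End\<^esub>"
  shows "u \<in> Units End"
proof -
  note lin = Hom_degD(2)[OF u(1)]
  have nz: "\<not> (\<forall>x\<in>carrier S. u x = \<zero>\<^bsub>S\<^esub>)"
    using u(2) End_eqI[OF Hom_degD(1)[OF u(1)], of "\<zero>\<^bsub>End\<^esub>"] by (auto simp: End_apply)
  have simpleD: "N = {\<zero>\<^bsub>S\<^esub>} \<or> N = carrier S" if "dg_submodule A S N" for N
    using simple that by (auto simp: dg_simple_def)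
  \<comment> \<open>A kernel equal to \<open>S\<close> would force u = 0; below, an image equal to
    zero is excluded for the same reason.\<close>
  have ker: "{x \<in> carrier S. u x = \<zero>\<^bsub>S\<^esub>} = {\<zero>\<^bsub>S\<^esub>}"
    using simpleD[OF dg_submodule_kernel[OF u(1,3)]] nz by blast
  have "inj_on u (carrier S)"
  proof (rule inj_onI)
    fix x y assume xy: "x \<in> carrier S" "y \<in> carrier S" "u x = u y"
    then have "u (x \<ominus>\<^bsub>S\<^esub> y) = \<zero>\<^bsub>S\<^esub>"
      by (simp add: S.minus_eq K_linearD[OF lin] K_linear_minus[OF lin] S.r_neg)
    then have "x \<ominus>\<^bsub>S\<^esub> y = \<zero>\<^bsub>S\<^esub>" using ker xy by blast
    then show "x = y" using xy S.minus_eq_zeroD by blast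
  qed
  moreover have img: "u ` carrier S = carrier S"
    using simpleD[OF dg_submodule_image[OF u(1,3)]] nz by blast
  ultimately have bij: "bij_betw u (carrier S) (carrier S)" by (simp add: bij_betw_def)
  let ?v = "\<lambda>y\<in>carrier S. the_inv_into (carrier S) u y"
  have v: "?v \<in> carrier End" using Hom_deg_carrier[OF Hom_deg_inverse[OF u(1) bij]] .
  have "?v \<otimes>\<^bsub>End\<^esub> u = \<one>\<^bsub>End\<^esub>"
    by (rule End_eqI)
      (use bij Hom_degD(5)[OF u(1)] in \<open>auto simp: End_apply bij_betw_def the_inv_into_f_f\<close>)
  moreover have "u \<otimes>\<^bsub>End\<^esub> ?v = \<one>\<^bsub>End\<^esub>"
    by (rule End_eqI) (use bij in \<open>auto simp: End_apply bij_betw_def f_the_inv_into_f\<close>)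
  ultimately show ?thesis
    using v Hom_deg_carrier[OF u(1)] by (auto simp: Units_def)
qed

end

theorem proposition2p14:
  fixes K :: "('k, 'l) ring_scheme"
    and A :: "('k, 'a, 'm) dg_scheme"
    and S :: "('a, 's, 'n) dg_scheme"
  assumes "field K"
    and "dg_algebra K A"
    and "dg_simple K A S"
  shows "dg_division_algebra K (dg_End K A S) \<and>
    {u \<in> homogeneous (dg_ker (dg_End K A S)). left_regular (dg_ker (dg_End K A S)) u} =
    {u \<in> homogeneous (dg_ker (dg_End K A S)). right_regular (dg_ker (dg_End K A S)) u}"
proof -
  interpret S: dg_left_module K A S
    using assms(3) by (simp add: dg_simple_def)
  interpret E: dg_algebra K S.End by (rule S.dg_End_dg_algebra)
  have units: "u \<in> Units S.End"
    if "u \<in> grade S.End n" "u \<noteq> \<zero>\<^bsub>S.End\<^esub>" "differential S.End u = \<zero>\<^bsub>S.End\<^esub>" for u n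
    using S.nonzero_cycle_Units[OF assms(3)] that by (simp add: S.End_simps(7))
  \<comment> \<open>A nonzero point of \<open>S\<close> separates the identity from the zero
    map.\<close>
  have "carrier S \<noteq> {\<zero>\<^bsub>S\<^esub>}" using assms(3) by (simp add: dg_simple_def)
  then obtain x where "x \<in> carrier S" "x \<noteq> \<zero>\<^bsub>S\<^esub>" using S.S.zero_closed by blast
  then have one: "\<one>\<^bsub>S.End\<^esub> \<noteq> \<zero>\<^bsub>S.End\<^esub>"
    using S.End_apply(2,3)[of x] by metis
  have "dg_division_algebra K S.End"
    by (rule E.dg_division_algebraI) (rule units)
  moreover have "left_regular (dg_ker S.End) u \<longleftrightarrow> right_regular (dg_ker S.End) u"
    if u: "u \<in> homogeneous (dg_ker S.End)" for u
  proof -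
    have "left_regular (dg_ker S.End) u \<longleftrightarrow> u \<noteq> \<zero>\<^bsub>S.End\<^esub>"
      by (rule E.regular_cycle_iff(1)) (use units one u in blast)+
    moreover have "right_regular (dg_ker S.End) u \<longleftrightarrow> u \<noteq> \<zero>\<^bsub>S.End\<^esub>"
      by (rule E.regular_cycle_iff(2)) (use units one u in blast)+
    ultimately show ?thesis by simp
  qed
  ultimately show ?thesis by blast
qed

end
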